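(* Let $u,\psi\in\mathcal{H}(\mathbb{C})$, $n\in\{0,1,2,\dots\}$, and $1\leq p,q\leq\infty$. Then $D_{(u,\psi,n)}:\mathcal{F}_p\to\mathcal{F}_q$ is order bounded if and only if $L_{(u,\psi,n)}\in L^q(\mathbb{C},dA)$.
   Context: $\mathcal{H}(\mathbb{C})$ denotes the set of entire functions on $\mathbb{C}$ and $A$ is the Lebesgue area measure. The Fock space is $\mathcal{F}_p=\{f\in\mathcal{H}(\mathbb{C}):\|f\|_p<\infty\}$, where $\|f\|_p=\big(\frac{p}{2\pi}\int_{\mathbb{C}}|f(z)|^pe^{-\frac p2|z|^2}dA(z)\big)^{1/p}$ for $1\leq p<\infty$ and $\|f\|_\infty=\sup_{z\in\mathbb{C}}|f(z)|e^{-\frac12|z|^2}$. For $u,\psi\in\mathcal{H}(\mathbb{C})$ and $n\in\{0,1,2,\dots\}$, the weighted composition–differentiation operator is $D_{(u,\psi,n)}f=u\cdot(f^{(n)}\circ\psi)$, where $f^{(n)}$ is the $n$-th derivative and $f^{(0)}=f$, and $$L_{(u,\psi,n)}(z)=|u(z)|\,|\psi(z)|^n\,e^{\frac12(|\psi(z)|^2-|z|^2)},\qquad z\in\mathbb{C}.$$ An operator $T$ from $\mathcal{F}_p$ to $\mathcal{F}_q$ is order bounded if there exists a positive function $h\in L^q\big(\mathbb{C},e^{-\frac q2|z|^2}dA(z)\big)$ such that for all $f\in\mathcal{F}_p$ with $\|f\|_p\leq1$ one has $|Tf(z)|\leq h(z)$ for almost every $z\in\mathbb{C}$ with respect to $A$.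 For $q=\infty$, the condition on $h$ is understood as $\operatorname{ess\,sup}_{z\in\mathbb{C}}h(z)e^{-\frac12|z|^2}<\infty$.
   Formalization: When n ≥ 1 and ψ is identically 0, it is additionally assumed that D_(u,ψ,n) maps F_p into F_q; otherwise the claim fails there (L = 0, but e.g. u(z) = exp(z²) gives an operator that is not order bounded). *)

theory Defs
  imports "HOL-Complex_Analysis.Complex_Analysis" "HOL-Probability.Essential_Supremum"
begin

text \<open>
  Exponents \<open>1 \<le> p \<le> \<infinity>\<close> are elements of \<^typ>\<open>ennreal\<close>; for finite \<open>p\<close> the real exponent
  is \<^term>\<open>enn2real p\<close>. The area measure is \<^term>\<open>lebesgue :: complex measure\<close>.
\<close>

text \<open>The case split gives \<open>\<infinity>\<^sup>1\<^sup>/\<^sup>p = \<infinity>\<close>: there is no real power on \<^typ>\<open>ennreal\<close>.\<close>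

definition fock_norm :: "ennreal \<Rightarrow> (complex \<Rightarrow> complex) \<Rightarrow> ennreal" where
  "fock_norm p f =
     (if p = \<infinity> then (SUP z. ennreal (cmod (f z) * exp (- (1/2) * (cmod z)\<^sup>2)))
      else let r = enn2real p;
               I = ennreal (r / (2 * pi)) *
                   (\<integral>\<^sup>+ z. ennreal (cmod (f z) powr r * exp (- (r/2) * (cmod z)\<^sup>2)) \<partial>lebesgue)
           in if I = \<infinity> then \<infinity> else ennreal (enn2real I powr (1 / r)))"

definition fock_space :: "ennreal \<Rightarrow> (complex \<Rightarrow> complex) set" where
  "fock_space p = {f. f holomorphic_on UNIV \<and> fock_norm p f < \<infinity>}"

definition Lebesgue_space :: "ennreal \<Rightarrow> 'a measure \<Rightarrow> ('a \<Rightarrow> real) set" where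
  "Lebesgue_space q M =
     {h \<in> borel_measurable M.
        if q = \<infinity> then esssup M (\<lambda>x. ennreal \<bar>h x\<bar>) < \<infinity>
        else (\<integral>\<^sup>+ x. ennreal (\<bar>h x\<bar> powr enn2real q) \<partial>M) < \<infinity>}"

text \<open>
  The Gaussian-weighted space. For \<open>q = \<infinity>\<close> the weight multiplies the function rather than
  the measure.
\<close>

definition weighted_Lebesgue_space :: "ennreal \<Rightarrow> (complex \<Rightarrow> real) set" where
  "weighted_Lebesgue_space q =
     (if q = \<infinity>
      then {h \<in> borel_measurable lebesgue.
              esssup lebesgue (\<lambda>z. ennreal (\<bar>h z\<bar> * exp (- (1/2) * (cmod z)\<^sup>2))) < \<infinity>}
      else Lebesgue_space q
             (density lebesgue (\<lambda>z. ennreal (exp (- (enn2real q / 2) * (cmod z)\<^sup>2)))))"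

text \<open>Being an operator from \<open>\<F>\<^sub>p\<close> to \<open>\<F>\<^sub>q\<close> is part of order boundedness.\<close>

definition order_bounded ::
    "ennreal \<Rightarrow> ennreal \<Rightarrow> ((complex \<Rightarrow> complex) \<Rightarrow> (complex \<Rightarrow> complex)) \<Rightarrow> bool" where
  "order_bounded p q T \<longleftrightarrow>
     T \<in> fock_space p \<rightarrow> fock_space q \<and>
     (\<exists>h \<in> weighted_Lebesgue_space q.
        (\<forall>z. h z > 0) \<and>
        (\<forall>f \<in> fock_space p. fock_norm p f \<le> 1 \<longrightarrow> (AE z in lebesgue. cmod (T f z) \<le> h z)))"

definition weighted_comp_diff ::
    "(complex \<Rightarrow> complex) \<Rightarrow> (complex \<Rightarrow> complex) \<Rightarrow> nat \<Rightarrow> (complex \<Rightarrow> complex) \<Rightarrow> (complex \<Rightarrow> complex)"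
  where "weighted_comp_diff u \<psi> n f = (\<lambda>z. u z * (deriv ^^ n) f (\<psi> z))"

definition L_fun :: "(complex \<Rightarrow> complex) \<Rightarrow> (complex \<Rightarrow> complex) \<Rightarrow> nat \<Rightarrow> complex \<Rightarrow> real" where
  "L_fun u \<psi> n z = cmod (u z) * cmod (\<psi> z) ^ n * exp ((1/2) * ((cmod (\<psi> z))\<^sup>2 - (cmod z)\<^sup>2))"

end

theory Submission
  imports Defs
    "HOL-Probability.Distributions"
    "HOL-Real_Asymp.Real_Asymp"
    "HOL-Computational_Algebra.Fundamental_Theorem_Algebra"
begin

text \<open>
  If \<open>h\<close> dominates the image of the unit ball, then testing on the normalized kernels
  \<open>exp (cnj w * z - |w|\<^sup>2 / 2)\<close> for \<open>w\<close> in a countable dense set, extending to all \<open>w\<close> by continuity and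
  putting \<open>w = \<psi> z\<close> bounds \<open>L\<close> by a multiple of \<open>h exp (-|z|\<^sup>2 / 2)\<close>.

  Conversely, an area mean value inequality and Cauchy's estimate on circles of radius \<open>1 / (1 + |w|)\<close>
  give \<open>|f\<^sup>(\<^sup>n\<^sup>) w| \<le> K (1 + |w|)\<^sup>n exp (|w|\<^sup>2 / 2)\<close> on the unit ball. This is the required bound
  except where \<open>\<psi>\<close> is small and \<open>n > 0\<close>. But \<open>L \<in> L\<^sup>q\<close> makes \<open>L\<close> bounded, which forces \<open>\<psi>\<close> to be a
  polynomial (of degree at most 2, which suffices), so \<open>\<psi>\<close> is constant or small only on a bounded set.
\<close>

section \<open>Entire functions of Gaussian growth\<close>

text \<open>The removable singularity theorem makes the difference quotient entire. Iterating it at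
  \<open>0\<close> splits off Taylor terms one at a time.\<close>

lemma entire_divided_difference:
  assumes "f holomorphic_on UNIV"
  obtains g where "g holomorphic_on UNIV" "\<And>z. f z = f a + (z - a) * g z"
proof
  show "(\<lambda>z. if z = a then deriv f a else (f z - f a) / (z - a)) holomorphic_on UNIV"
    using assms by (rule pole_lemma_open) simp
qed auto

text \<open>On the circle \<open>Re (H z) <= |\<psi> z| <= |\<psi> z|^2 / 2 + 1/2\<close>, so the
  growth bound controls \<open>v * exp H\<close> there, and the maximum modulus principle carries
  the estimate to \<open>a\<close>. Since \<open>l\<close> enters only through its values on the
  circle, it may have a pole inside.\<close>

lemma cmod_mult_exp_le_on_circle:
  assumes "\<And>z. cmod (v z) * exp ((cmod (\<psi> z))\<^sup>2 / 2) \<le> B * exp ((cmod z)\<^sup>2 / 2)"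
    and "v holomorphic_on UNIV" "H holomorphic_on UNIV" "0 \<le> B" "cmod a < r" 
    and l: "\<And>z. cmod z = r \<Longrightarrow> cmod (l z) = 1 \<and> Re (H z) = Re (l z * \<psi> z)"
  shows "cmod (v a) * exp (Re (H a)) \<le> B * exp ((r\<^sup>2 + 1) / 2)"
proof -
  have "norm (v a * exp (H a)) \<le> B * exp ((r\<^sup>2 + 1) / 2)"
  proof (rule maximum_modulus_frontier[of "\<lambda>z. v z * exp (H z)" "ball 0 r"])
    have hol: "(\<lambda>z. v z * exp (H z)) holomorphic_on UNIV"
      using assms by (intro holomorphic_intros) auto
    then show "(\<lambda>z. v z * exp (H z)) holomorphic_on interior (ball 0 r)"
      "continuous_on (closure (ball 0 r)) (\<lambda>z. v z * exp (H z))"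
      by (auto intro: holomorphic_on_subset holomorphic_on_imp_continuous_on continuous_on_subset)
    fix z :: complex assume "z \<in> frontier (ball 0 r)"
    moreover have "0 < r" using \<open>cmod a < r\<close> norm_ge_zero[of a] by linarith
    ultimately have z: "cmod z = r" by (simp add: frontier_ball)
    have "Re (H z) \<le> cmod (l z * \<psi> z)" using l[OF z] complex_Re_le_cmod by metis
    also have "\<dots> = cmod (\<psi> z)" using l[OF z] by (simp add: norm_mult)
    also have "\<dots> \<le> (cmod (\<psi> z))\<^sup>2 / 2 + 1 / 2"
      using zero_le_power2[of "cmod (\<psi> z) - 1"] by (simp add: power2_eq_square algebra_simps)
    finally have "cmod (v z * exp (H z)) \<le> cmod (v z) * (exp ((cmod (\<psi> z))\<^sup>2 / 2) * exp (1/2))"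
      by (simp add: norm_mult mult_left_mono flip: exp_add)
    also have "\<dots> \<le> (B * exp (r\<^sup>2 / 2)) * exp (1/2)"
      using assms(1)[of z] z by (simp add: mult_right_mono flip: mult.assoc)
    also have "\<dots> = B * exp ((r\<^sup>2 + 1) / 2)"
      by (simp add: mult.assoc add_divide_distrib flip: exp_add)
    finally show "norm (v z * exp (H z)) \<le> B * exp ((r\<^sup>2 + 1) / 2)" .
  qed (use assms in auto)
  then show ?thesis by (simp add: norm_mult)
qed

text \<open>
  On \<open>|z| = r\<close> one has \<open>|\<psi>|\<^sup>2 / 2 \<ge> Re (l \<psi>) - 1/2\<close> for unimodular \<open>l\<close>. With \<open>l\<close> a multiple of
  \<open>z\<^sup>-\<^sup>3\<close>, the polar part of \<open>l \<psi>\<close> can be reflected in the circle without changing its real part,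
  so the maximum principle turns the growth bound into a bound on the cubic remainder of \<open>\<psi>\<close>.
\<close>

lemma quadratic_if_gaussian_growth:
  assumes v: "v holomorphic_on UNIV" and \<psi>: "\<psi> holomorphic_on UNIV" and "v w \<noteq> 0"
    and le: "\<And>z. cmod (v z) * exp ((cmod (\<psi> z))\<^sup>2 / 2) \<le> B * exp ((cmod z)\<^sup>2 / 2)"
  obtains b0 b1 b2 where "\<And>z. \<psi> z = b0 + b1 * z + b2 * z\<^sup>2"
proof -
  \<comment> \<open>Three divisions by \<open>z\<close> write \<open>\<psi>\<close> as a Taylor
    polynomial of degree at most 2 plus \<open>z ^ 3 * g z\<close>; the aim is
    \<open>g = 0\<close>.\<close>
  obtain g1 where g1: "g1 holomorphic_on UNIV" "\<And>z. \<psi> z = \<psi> 0 + (z - 0) * g1 z"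
    using entire_divided_difference[OF \<psi>, of 0] by auto
  obtain g2 where g2: "g2 holomorphic_on UNIV" "\<And>z. g1 z = g1 0 + (z - 0) * g2 z"
    using entire_divided_difference[OF g1(1), of 0] by auto
  obtain g where g: "g holomorphic_on UNIV" "\<And>z. g2 z = g2 0 + (z - 0) * g z"
    using entire_divided_difference[OF g2(1), of 0] by auto
  define b0 b1 b2 where b: "b0 = \<psi> 0" "b1 = g1 0" "b2 = g2 0"
  have \<psi>_eq: "\<psi> z = b0 + b1 * z + b2 * z\<^sup>2 + z ^ 3 * g z" for z
    using g1(2)[of z] g2(2)[of z] g(2)[of z]
    by (simp add: b power2_eq_square power3_eq_cube algebra_simps)
  have B: "0 \<le> B"
    using order_trans[OF _ le[of 0]] by simp
  \<comment> \<open>A nonzero \<open>g a\<close> would put a cubic term \<open>|g a| * r^3\<close>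
    into an exponent that the growth bound allows to be only quadratic in \<open>r\<close>.\<close>
  have g0: "g a = 0" if va: "v a \<noteq> 0" for a
  proof (rule ccontr)
    assume "g a \<noteq> 0"
    \<comment> \<open>This unimodular factor rotates \<open>g a\<close> onto the positive real
      axis.\<close>
    define \<omega> where "\<omega> = cnj (g a) / of_real (cmod (g a))"
    have \<omega>1: "cmod \<omega> = 1"
      using \<open>g a \<noteq> 0\<close> by (simp add: \<omega>_def norm_divide)
    have \<omega>g: "\<omega> * g a = of_real (cmod (g a))"
      using \<open>g a \<noteq> 0\<close> complex_norm_square[of "g a"]
      by (simp add: \<omega>_def field_simps power2_eq_square)
    \<comment> \<open>On \<open>|z| = r\<close> one has \<open>1 / z = cnj z / r^2\<close>, so
      conjugating the three polar terms of \<open>\<omega> * r^3 / z^3 * \<psi> z\<close> gives the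
      polynomial \<open>Q z r\<close>, with the same real part. For \<open>r > 1\<close> its modulus
      at \<open>a\<close> is at most \<open>K * r\<close>.\<close>
    define Q where "Q z r = cnj (\<omega> * b0) * z ^ 3 / of_real r ^ 3 + cnj (\<omega> * b1) * z\<^sup>2 / of_real r
         + cnj (\<omega> * b2) * z * of_real r" for z and r :: real
    define K where "K = cmod b0 * cmod a ^ 3 + cmod b1 * (cmod a)\<^sup>2 + cmod b2 * cmod a"
    have bound: "cmod (v a) * exp (cmod (g a) * r ^ 3 - K * r) \<le> B * exp ((r\<^sup>2 + 1) / 2)"
      if r: "r > cmod a" "r > 1" for r
    proof -
      define H where "H z = \<omega> * of_real r ^ 3 * g z + Q z r" for z
      define l where "l z = \<omega> * of_real r ^ 3 / z ^ 3" for z :: complex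
      have "Re (H z) = Re (l z * \<psi> z)" if "cmod z = r" for z
      proof -
        have "z \<noteq> 0" using that r by auto
        have cz: "z * cnj z = of_real r ^ 2" using that complex_norm_square[of z] by simp
        have c: "cnj z = of_real r ^ 2 / z" using cz \<open>z \<noteq> 0\<close> by (simp add: field_simps)
        have "l z * \<psi> z = \<omega> * of_real r ^ 3 * g z +
           (\<omega> * b0 * of_real r ^ 3 / z ^ 3 + \<omega> * b1 * of_real r ^ 3 / z\<^sup>2 + \<omega> * b2 * of_real r ^ 3 / z)"
          using \<open>z \<noteq> 0\<close> by (simp add: l_def \<psi>_eq field_simps power2_eq_square power3_eq_cube)
        also have "\<dots> = \<omega> * of_real r ^ 3 * g z + cnj (Q z r)"
          using \<open>z \<noteq> 0\<close> r by (simp add: Q_def c field_simps power2_eq_square power3_eq_cube)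
        finally show ?thesis by (simp add: H_def)
      qed
      moreover have "cmod (l z) = 1" if "cmod z = r" for z
        using that \<omega>1 r by (simp add: l_def norm_divide norm_mult norm_power)
      moreover have "H holomorphic_on UNIV"
        unfolding H_def Q_def using g(1) r by (intro holomorphic_intros) auto
      ultimately have "cmod (v a) * exp (Re (H a)) \<le> B * exp ((r\<^sup>2 + 1) / 2)"
        using le v B r by (intro cmod_mult_exp_le_on_circle[where l = l and \<psi> = \<psi>]) auto
      moreover have "cmod (g a) * r ^ 3 - K * r \<le> Re (H a)"
      proof -
        have "\<omega> * of_real r ^ 3 * g a = of_real (cmod (g a) * r ^ 3)"
          using \<omega>g by (simp add: mult_ac)
        then have "Re (H a) = cmod (g a) * r ^ 3 + Re (Q a r)"
          by (simp only: H_def plus_complex.sel Re_complex_of_real)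
        moreover have "cmod (Q a r) \<le> K * r"
        proof -
          have "cmod (Q a r) \<le> cmod b0 * cmod a ^ 3 / r ^ 3 + cmod b1 * (cmod a)\<^sup>2 / r + cmod b2 * cmod a * r"
            unfolding Q_def using r \<omega>1
            by (intro order_trans[OF norm_triangle_ineq] add_mono order.refl)
               (auto simp: norm_mult norm_divide norm_power)
          also have "\<dots> \<le> cmod b0 * cmod a ^ 3 * r + cmod b1 * (cmod a)\<^sup>2 * r + cmod b2 * cmod a * r"
          proof -
            have "1 / r ^ 3 \<le> r" "1 / r \<le> r"
              using r one_le_power[of r 4] one_le_power[of r 2] by (auto simp: divide_le_eq power_numeral_reduce mult_ac)
            then show ?thesis
              using mult_left_mono[of "1 / r ^ 3" r "cmod b0 * cmod a ^ 3"] mult_left_mono[of "1 / r" r "cmod b1 * (cmod a)\<^sup>2"]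
              by simp
          qed
          finally show ?thesis by (simp add: K_def algebra_simps)
        qed
        moreover have "- cmod (Q a r) \<le> Re (Q a r)"
          using abs_Re_le_cmod[of "Q a r"] by linarith
        ultimately show ?thesis by linarith
      qed
      ultimately show ?thesis
        by (smt (verit) exp_le_cancel_iff mult_left_mono norm_ge_zero)
    qed
    \<comment> \<open>The cubic term beats the quadratic one as \<open>r\<close> grows, which forces
      \<open>v a = 0\<close>.\<close>
    have "((\<lambda>r. B * exp ((r\<^sup>2 + 1) / 2 - (cmod (g a) * r ^ 3 - K * r))) \<longlongrightarrow> 0) at_top"
      using \<open>g a \<noteq> 0\<close> by real_asymp
    moreover have "\<forall>\<^sub>F r in at_top. cmod (v a) \<le> B * exp ((r\<^sup>2 + 1) / 2 - (cmod (g a) * r ^ 3 - K * r))"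
      using eventually_gt_at_top[of "cmod a"] eventually_gt_at_top[of 1]
    proof eventually_elim
      case (elim r)
      then show ?case using bound[of r] exp_diff[of "(r\<^sup>2 + 1) / 2" "cmod (g a) * r ^ 3 - K * r"]
        by (simp add: pos_le_divide_eq)
    qed
    ultimately have "cmod (v a) \<le> 0" by (intro tendsto_lowerbound) auto
    with va show False by simp
  qed
  \<comment> \<open>So far \<open>g\<close> vanishes on the open set where \<open>v\<close> is
    nonzero, which contains \<open>w\<close>; the identity theorem extends this to the
    plane.\<close>
  have "g z = 0" for z
  proof (rule analytic_continuation_open[of "{z. v z \<noteq> 0}" UNIV g "\<lambda>_. 0"])
    show "open {z. v z \<noteq> 0}"
      using v by (intro open_Collect_neq continuous_intros) (auto intro: holomorphic_on_imp_continuous_on)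
  qed (use g g0 \<open>v w \<noteq> 0\<close> in auto)
  then show ?thesis using \<psi>_eq that by simp
qed

section \<open>Lebesgue measure on the complex plane\<close>

lemma prod_Basis_complex: "(\<Prod>b\<in>Basis. f b) = f 1 * f \<i>" for f :: "complex \<Rightarrow> 'b::comm_monoid_mult"
  by (simp add: Basis_complex_def)

text \<open>Identifies the plane with \<open>real^2\<close>, where orthogonal maps preserve measure;
  agreement on boxes suffices.\<close>

lemma lborel_complex_eq_distr_vec:
  "(lborel :: complex measure) = distr lborel borel (\<lambda>v::real^2. Complex (vec_nth v 1) (vec_nth v 2))"
proof (rule lborel_eqI)
  have [measurable]: "(\<lambda>v::real^2. Complex (vec_nth v 1) (vec_nth v 2)) \<in> borel_measurable borel"
    by (intro borel_measurable_continuous_onI continuous_intros)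
  fix l u :: complex assume lu: "\<And>b. b \<in> Basis \<Longrightarrow> l \<bullet> b \<le> u \<bullet> b"
  have eq: "(\<lambda>v::real^2. Complex (vec_nth v 1) (vec_nth v 2)) -` box l u =
      box (vector [Re l, Im l]) (vector [Re u, Im u])"
    by (auto simp: box_def Basis_vec_def Basis_complex_def forall_2 inner_axis)
  have "\<And>b. b \<in> Basis \<Longrightarrow> (vector [Re l, Im l] :: real^2) \<bullet> b \<le> vector [Re u, Im u] \<bullet> b"
    using lu[of 1] lu[of \<i>] by (auto simp: Basis_vec_def inner_axis Basis_complex_def UNIV_2)
  then have "emeasure lborel (box (vector [Re l, Im l]) (vector [Re u, Im u] :: real^2)) =
      (\<Prod>b\<in>Basis. (vector [Re u, Im u] - vector [Re l, Im l] :: real^2) \<bullet> b)"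
    by (rule emeasure_lborel_box)
  also have "(\<Prod>b\<in>Basis. (vector [Re u, Im u] - vector [Re l, Im l] :: real^2) \<bullet> b) =
      (\<Prod>b\<in>Basis. (u - l) \<bullet> b)"
    by (simp add: Basis_vec_def prod_Basis_complex UNIV_2 inner_axis axis_eq_axis
        prod.insert_if insert_commute)
  finally show "emeasure (distr lborel borel (\<lambda>v::real^2. Complex (vec_nth v 1) (vec_nth v 2))) (box l u) =
      (\<Prod>b\<in>Basis. (u - l) \<bullet> b)"
    by (simp add: emeasure_distr eq)
qed simp

text \<open>The product form of area, for evaluating the Gaussian integral by Fubini.\<close>

lemma lborel_complex_eq_distr_pair:
  "(lborel :: complex measure) = distr (lborel \<Otimes>\<^sub>M lborel) borel (\<lambda>(x, y). Complex x y)"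
proof (rule lborel_eqI)
  have m [measurable]: "(\<lambda>(x, y). Complex x y) \<in> borel_measurable (borel \<Otimes>\<^sub>M borel)"
    unfolding borel_prod case_prod_beta
    by (intro borel_measurable_continuous_onI continuous_intros)
  fix l u :: complex assume lu: "\<And>b. b \<in> Basis \<Longrightarrow> l \<bullet> b \<le> u \<bullet> b"
  have "(\<lambda>(x, y). Complex x y) -` box l u = box (Re l) (Re u) \<times> box (Im l) (Im u)"
    by (auto simp: box_def Basis_complex_def)
  then show "emeasure (distr (lborel \<Otimes>\<^sub>M lborel) borel (\<lambda>(x, y). Complex x y)) (box l u) =
      (\<Prod>b\<in>Basis. (u - l) \<bullet> b)"
    using lu[of 1] lu[of \<i>] m
    by (simp add: emeasure_distr lborel.emeasure_pair_measure_Times prod_Basis_complex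
        space_pair_measure Basis_complex_def ennreal_mult)
qed simp

text \<open>Multiplication by a unimodular number is an orthogonal map of \<open>real^2\<close>, so
  it preserves the measure of boxes, and boxes determine the measure.\<close>

lemma lborel_complex_rotate:
  assumes "cmod c = 1"
  shows "distr lborel borel (\<lambda>z. c * z) = (lborel :: complex measure)"
proof (rule lborel_eqI[symmetric])
  define T where "T = (\<lambda>v::real^2. Complex (vec_nth v 1) (vec_nth v 2))"
  define S where "S = (\<lambda>z. vector [Re z, Im z] :: real^2)"
  \<comment> \<open>\<open>R\<close> is multiplication by \<open>cnj c\<close>, the inverse of
    \<open>c\<close>, seen on \<open>real^2\<close>. A preimage under multiplication by
    \<open>c\<close> thus becomes an image under \<open>R\<close>.\<close>
  define R where "R = (\<lambda>v. S (cnj c * T v))"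
  have T [measurable]: "T \<in> borel_measurable borel"
    unfolding T_def by (intro borel_measurable_continuous_onI continuous_intros)
  have ST: "S (T v) = v" "T (S z) = z" for v z
    by (simp_all add: S_def T_def vec_eq_iff forall_2)
  have cc: "c * cnj c = 1" "cnj c * c = 1"
    using assms complex_norm_square[of c] by (simp_all add: mult.commute)
  have normS: "norm (S z) = cmod z" for z
    by (simp add: S_def norm_vec_def L2_set_def UNIV_2 cmod_def)
  have normT: "cmod (T v) = norm v" for v
    using normS[of "T v"] by (simp add: ST)
  have "linear R"
    by (rule linearI) (simp_all add: R_def S_def T_def vec_eq_iff forall_2 algebra_simps)
  then have orth: "orthogonal_transformation R"
    by (simp add: orthogonal_transformation R_def normS norm_mult assms normT)
  fix l u :: complex assume lu: "\<And>b. b \<in> Basis \<Longrightarrow> l \<bullet> b \<le> u \<bullet> b"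
  let ?X = "T -` box l u"
  have X: "?X \<in> sets borel" using measurable_sets[OF T, of "box l u"] by simp
  have Xm: "emeasure lborel ?X = (\<Prod>b\<in>Basis. (u - l) \<bullet> b)"
    using lu X by (subst emeasure_lborel_box[symmetric])
      (auto simp: lborel_complex_eq_distr_vec emeasure_distr simp flip: T_def)
  then have Xl: "?X \<in> lmeasurable"
    using X by (auto simp: fmeasurable_def emeasure_completion)
  have "R ` ?X = T -` ((\<lambda>z. c * z) -` box l u)"
  proof (intro equalityI subsetI)
    fix v assume "v \<in> T -` ((\<lambda>z. c * z) -` box l u)"
    then have "v = R (S (c * T v))" "S (c * T v) \<in> ?X"
      by (auto simp: R_def ST cc mult.assoc[symmetric])
    then show "v \<in> R ` ?X" by blast
  qed (auto simp: R_def ST cc mult.assoc[symmetric])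
  moreover have c [measurable]: "(\<lambda>z. c * z) \<in> borel_measurable borel" by simp
  ultimately have *: "emeasure (distr lborel borel (\<lambda>z. c * z)) (box l u) = emeasure lborel (R ` ?X)"
    and RX: "R ` ?X \<in> sets borel"
    using measurable_sets[OF c, of "box l u"] measurable_sets[OF T, of "(\<lambda>z. c * z) -` box l u"]
    by (simp_all add: emeasure_distr) (simp add: lborel_complex_eq_distr_vec emeasure_distr flip: T_def)
  note *
  also have "emeasure lborel (R ` ?X) = emeasure lebesgue (R ` ?X)"
    using RX by (simp add: emeasure_completion)
  also have "\<dots> = emeasure lebesgue ?X"
    using measure_orthogonal_image[OF orth Xl] measurable_orthogonal_image[OF orth Xl] Xl
    by (simp add: emeasure_eq_measure2)
  also have "\<dots> = emeasure lborel ?X"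
    using X by (simp add: emeasure_completion)
  finally show "emeasure (distr lborel borel (\<lambda>z. c * z)) (box l u) = (\<Prod>b\<in>Basis. (u - l) \<bullet> b)"
    using Xm by simp
qed simp

lemma nn_integral_lborel_rotate:
  fixes f :: "complex \<Rightarrow> ennreal"
  assumes "f \<in> borel_measurable borel" "cmod c = 1"
  shows "(\<integral>\<^sup>+ z. f (c * z) \<partial>lborel) = (\<integral>\<^sup>+ z. f z \<partial>lborel)"
  using assms nn_integral_distr[of "\<lambda>z. c * z" lborel borel f] by (simp add: lborel_complex_rotate)

lemma nn_integral_lborel_translate:
  fixes f :: "'a::euclidean_space \<Rightarrow> ennreal"
  assumes "f \<in> borel_measurable borel"
  shows "(\<integral>\<^sup>+ z. f (c + z) \<partial>lborel) = (\<integral>\<^sup>+ z. f z \<partial>lborel)"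
  using assms nn_integral_distr[of "\<lambda>z. c + z" lborel borel f] by (simp add: lborel_distr_plus)

section \<open>Mean value inequalities on circles and discs\<close>

text \<open>Cauchy's integral formula on the unit circle for
  \<open>u \<mapsto> g (z + u * \<zeta>)\<close>, evaluated at the centre. The parameter
  \<open>\<zeta>\<close> is an arbitrary complex number so that it can be integrated over a disc
  afterwards.\<close>

lemma entire_circle_mean:
  assumes g: "g holomorphic_on UNIV"
  shows "ennreal (cmod (g z)) \<le>
    (\<integral>\<^sup>+ t. ennreal (cmod (g (z + exp (2 * of_real pi * \<i> * of_real t) * \<zeta>))) * indicator {0..1} t \<partial>lborel)"
    (is "_ \<le> ?R")
proof -
  define e where "e t = exp (2 * of_real pi * \<i> * of_real t)" for t :: real
  define F where "F t = g (z + e t * \<zeta>)" for t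
  have cont: "continuous_on {0..1} F"
    unfolding F_def e_def
    by (intro continuous_on_compose2[OF holomorphic_on_imp_continuous_on[OF g]] continuous_intros) auto
  have "(\<lambda>u. g (z + u * \<zeta>)) holomorphic_on UNIV"
    by (intro holomorphic_on_compose_gen[OF _ g, unfolded o_def] holomorphic_intros) auto
  then have "((\<lambda>u. g (z + u * \<zeta>) / (u - 0)) has_contour_integral 2 * of_real pi * \<i> * g (z + 0 * \<zeta>))
      (circlepath 0 1)"
    by (intro Cauchy_integral_circlepath_simple[of "\<lambda>u. g (z + u * \<zeta>)"]) (auto intro: holomorphic_on_subset)
  then have "((\<lambda>t. g (z + circlepath 0 1 t * \<zeta>) / (circlepath 0 1 t - 0) *
      vector_derivative (circlepath 0 1) (at t within {0..1})) has_integral 2 * of_real pi * \<i> * g z) {0..1}"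
    by (simp add: has_contour_integral_def)
  \<comment> \<open>The derivative of the path contributes a factor \<open>e t\<close>, which
    cancels the denominator and leaves the constant \<open>2 * pi * \<i>\<close>.\<close>
  moreover have "g (z + circlepath 0 1 t * \<zeta>) / (circlepath 0 1 t - 0) *
      vector_derivative (circlepath 0 1) (at t within {0..1}) = (2 * of_real pi * \<i>) * F t"
    if "t \<in> {0..1}" for t
  proof -
    have "vector_derivative (circlepath 0 1) (at t within {0..1}) = 2 * of_real pi * \<i> * e t"
      using that vector_derivative_circlepath01[of t 0 1] by (simp add: e_def)
    moreover have "circlepath 0 1 t = e t"
      by (simp add: circlepath e_def)
    ultimately show ?thesis
      by (simp add: F_def) (simp add: e_def)
  qed
  ultimately have "((\<lambda>t. (2 * of_real pi * \<i>) * F t) has_integral (2 * of_real pi * \<i>) * g z) {0..1}"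
    by (subst (asm) has_integral_cong) auto
  from has_integral_mult_right[OF this, of "1 / (2 * of_real pi * \<i>)"]
  have int: "(F has_integral g z) {0..1}"
    by simp
  have nint: "(\<lambda>t. cmod (F t)) integrable_on {0..1}"
    by (intro integrable_continuous_interval continuous_intros cont)
  then have "cmod (g z) \<le> integral {0..1} (\<lambda>t. cmod (F t))"
    using integral_norm_bound_integral[of F "{0..1}" "\<lambda>t. cmod (F t)"] int
    by (simp add: has_integral_iff)
  also have "ennreal (integral {0..1} (\<lambda>t. cmod (F t))) =
      (\<integral>\<^sup>+ t. ennreal (cmod (F t)) * indicator {0..1} t \<partial>lborel)"
    using nint by (subst nn_integral_has_integral_lebesgue') (auto simp: has_integral_integral)
  finally show ?thesis by (simp add: F_def e_def ennreal_leI)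
qed

text \<open>
  Averaging over rotations of the disc instead of using polar coordinates.
\<close>

lemma entire_area_mean:
  assumes g: "g holomorphic_on UNIV"
  shows "emeasure lborel (ball (0::complex) 1) * ennreal (cmod (g z)) \<le>
    (\<integral>\<^sup>+ w. ennreal (cmod (g w)) * indicator (ball z 1) w \<partial>lborel)"
proof -
  have gm [measurable]: "g \<in> borel_measurable borel"
    using g by (intro borel_measurable_continuous_onI holomorphic_on_imp_continuous_on)
  have [measurable]: "ball a r \<in> sets borel" for a :: complex and r
    by simp
  define e where "e t = exp (2 * of_real pi * \<i> * of_real t)" for t :: real
  have em [measurable]: "e \<in> borel_measurable borel"
    unfolding e_def by (intro borel_measurable_continuous_onI continuous_intros)
  have e1: "cmod (e t) = 1" for t
    using norm_exp_i_times[of "2 * pi * t"] by (simp add: e_def mult_ac)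
  define f where "f \<zeta> = ennreal (cmod (g (z + \<zeta>))) * indicator (ball 0 1) \<zeta>" for \<zeta>
  have fm [measurable]: "f \<in> borel_measurable borel"
    unfolding f_def by measurable
  have fe: "f (e t * \<zeta>) = ennreal (cmod (g (z + e t * \<zeta>))) * indicator (ball 0 1) \<zeta>" for t \<zeta>
    by (simp add: f_def indicator_def norm_mult e1)
  have "emeasure lborel (ball (0::complex) 1) * ennreal (cmod (g z)) =
      (\<integral>\<^sup>+ \<zeta>. ennreal (cmod (g z)) * indicator (ball (0::complex) 1) \<zeta> \<partial>lborel)"
    by (subst nn_integral_cmult_indicator) (auto simp: mult.commute)
  \<comment> \<open>Rotation preserves the disc, so the cutoff in \<open>f\<close> does not depend
    on \<open>t\<close>. Inside the disc this is the circle mean; outside, the left side is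
    zero.\<close>
  also have "\<dots> \<le> (\<integral>\<^sup>+ \<zeta>. (\<integral>\<^sup>+ t. f (e t * \<zeta>) * indicator {0..1} t \<partial>lborel) \<partial>lborel)"
  proof (intro nn_integral_mono)
    fix \<zeta> :: complex
    show "ennreal (cmod (g z)) * indicator (ball 0 1) \<zeta> \<le> (\<integral>\<^sup>+ t. f (e t * \<zeta>) * indicator {0..1} t \<partial>lborel)"
      using entire_circle_mean[OF g, of z \<zeta>]
      by (cases "\<zeta> \<in> ball 0 1") (auto simp: fe simp flip: e_def)
  qed
  also have "\<dots> = (\<integral>\<^sup>+ t. (\<integral>\<^sup>+ \<zeta>. f (e t * \<zeta>) * indicator {0..1} t \<partial>lborel) \<partial>lborel)"
    by (rule lborel_pair.Fubini') measurable
  \<comment> \<open>Rotation invariance removes \<open>e t\<close>; the remaining integral over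
    \<open>t\<close> has total mass 1.\<close>
  also have "\<dots> = (\<integral>\<^sup>+ t. (\<integral>\<^sup>+ \<zeta>. f \<zeta> \<partial>lborel) * indicator {0..1::real} t \<partial>lborel)"
    by (intro nn_integral_cong) (simp add: nn_integral_multc nn_integral_lborel_rotate e1)
  also have "\<dots> = (\<integral>\<^sup>+ \<zeta>. f \<zeta> \<partial>lborel)"
    by (subst nn_integral_cmult_indicator) auto
  also have "\<dots> = (\<integral>\<^sup>+ \<zeta>. ennreal (cmod (g (z + \<zeta>))) * indicator (ball z 1) (z + \<zeta>) \<partial>lborel)"
    by (intro nn_integral_cong) (simp add: f_def indicator_def dist_norm)
  also have "\<dots> = (\<integral>\<^sup>+ w. ennreal (cmod (g w)) * indicator (ball z 1) w \<partial>lborel)"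
    by (rule nn_integral_lborel_translate) measurable
  finally show ?thesis .
qed

text \<open>Polarization, used to complete the square in the exponents of kernel functions.\<close>

lemma Re_cnj_mult: "Re (cnj a * b) = ((cmod a)\<^sup>2 + (cmod b)\<^sup>2 - (cmod (b - a))\<^sup>2) / 2"
  unfolding cmod_power2 by (simp add: power2_eq_square field_simps)

lemma L_fun_nonneg: "0 \<le> L_fun u \<psi> n z"
  by (simp add: L_fun_def)

text \<open>
  For fixed \<open>z\<close>, \<^const>\<open>L_fun\<close> agrees at \<open>z\<close> with the modulus of an entire function that it
  dominates on \<open>ball z 1\<close> up to a factor \<open>\<surd>e\<close>.
\<close>

lemma L_fun_area_mean:
  assumes u: "u holomorphic_on UNIV" and \<psi>: "\<psi> holomorphic_on UNIV"
  shows "emeasure lborel (ball (0::complex) 1) * ennreal (L_fun u \<psi> n z) \<le>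
    ennreal (exp (1/2)) * (\<integral>\<^sup>+ w. ennreal (L_fun u \<psi> n w) * indicator (ball z 1) w \<partial>lborel)"
proof -
  \<comment> \<open>The real part of the exponent is \<open>(|\<psi> w|^2 - |w|^2) / 2\<close> plus
    \<open>(|w - z|^2 - |\<psi> w - \<psi> z|^2) / 2\<close>. The second term is zero at
    \<open>w = z\<close> and at most \<open>1/2\<close> on the unit ball about
    \<open>z\<close>.\<close>
  define G where "G w = u w * \<psi> w ^ n * exp (cnj (\<psi> z) * \<psi> w - of_real ((cmod (\<psi> z))\<^sup>2 / 2) - cnj z * w + of_real ((cmod z)\<^sup>2 / 2))" for w
  have [measurable]: "ball z 1 \<in> sets borel"
    by simp
  have hol: "G holomorphic_on UNIV"
    unfolding G_def by (intro holomorphic_intros u \<psi>)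
  have cmodG: "cmod (G w) = L_fun u \<psi> n w * exp ((cmod (w - z))\<^sup>2 / 2 - (cmod (\<psi> w - \<psi> z))\<^sup>2 / 2)" for w
  proof -
    have "Re (cnj (\<psi> z) * \<psi> w - of_real ((cmod (\<psi> z))\<^sup>2 / 2) - cnj z * w + of_real ((cmod z)\<^sup>2 / 2)) =
        (1/2) * ((cmod (\<psi> w))\<^sup>2 - (cmod w)\<^sup>2) + ((cmod (w - z))\<^sup>2 / 2 - (cmod (\<psi> w - \<psi> z))\<^sup>2 / 2)"
      unfolding plus_complex.sel minus_complex.sel Re_complex_of_real Re_cnj_mult
      by (simp add: field_simps)
    then show ?thesis
      unfolding G_def L_fun_def norm_mult norm_power norm_exp_eq_Re by (simp only: exp_add mult_ac)
  qed
  have "(\<integral>\<^sup>+ w. ennreal (cmod (G w)) * indicator (ball z 1) w \<partial>lborel) \<le>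
     (\<integral>\<^sup>+ w. ennreal (exp (1/2)) * (ennreal (L_fun u \<psi> n w) * indicator (ball z 1) w) \<partial>lborel)"
  proof (intro nn_integral_mono)
    fix w
    have "cmod (G w) \<le> exp (1/2) * L_fun u \<psi> n w" if "cmod (w - z) < 1"
    proof -
      have "(cmod (w - z))\<^sup>2 \<le> 1" using that by (simp add: power_le_one)
      then have "(cmod (w - z))\<^sup>2 / 2 - (cmod (\<psi> w - \<psi> z))\<^sup>2 / 2 \<le> 1 / 2"
        using zero_le_power2[of "cmod (\<psi> w - \<psi> z)"] by linarith
      then show ?thesis
        unfolding cmodG by (subst mult.commute) (intro mult_right_mono L_fun_nonneg, simp)
    qed
    then show "ennreal (cmod (G w)) * indicator (ball z 1) w \<le>
       ennreal (exp (1/2)) * (ennreal (L_fun u \<psi> n w) * indicator (ball z 1) w)"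
      by (auto simp: indicator_def dist_norm norm_minus_commute L_fun_nonneg ennreal_mult'[symmetric] intro!: ennreal_leI)
  qed
  also have "\<dots> = ennreal (exp (1/2)) * (\<integral>\<^sup>+ w. ennreal (L_fun u \<psi> n w) * indicator (ball z 1) w \<partial>lborel)"
  proof -
    have "(\<lambda>w. L_fun u \<psi> n w) \<in> borel_measurable borel"
      unfolding L_fun_def using u \<psi>
      by (intro borel_measurable_continuous_onI continuous_intros holomorphic_on_imp_continuous_on)
    then have "(\<lambda>w. ennreal (L_fun u \<psi> n w) * indicator (ball z 1) w) \<in> borel_measurable borel"
      by measurable
    then show ?thesis by (intro nn_integral_cmult) simp
  qed
  finally show ?thesis
    using entire_area_mean[OF hol, of z] cmodG[of z] by simp
qed

text \<open>In real coordinates the integrand is a product of two unnormalized standard normal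
  densities, each with integral \<open>sqrt (2 * pi)\<close>.\<close>

lemma nn_integral_gaussian_finite:
  "(\<integral>\<^sup>+ z. ennreal (exp (- (1/2) * (cmod z)\<^sup>2)) \<partial>lborel) < \<infinity>"
proof -
  have 1: "(\<integral>\<^sup>+ x. ennreal (exp (- (1/2) * x\<^sup>2)) \<partial>(lborel :: real measure)) = ennreal (sqrt (2 * pi))"
  proof -
    have "(\<integral>\<^sup>+ x. ennreal (exp (- (1/2) * x\<^sup>2)) \<partial>(lborel :: real measure)) =
        (\<integral>\<^sup>+ x. ennreal (sqrt (2 * pi)) * ennreal (std_normal_density x) \<partial>lborel)"
      by (intro nn_integral_cong) (simp add: std_normal_density_def flip: ennreal_mult)
    also have "\<dots> = ennreal (sqrt (2 * pi)) * 1"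
      using prob_space.emeasure_space_1[OF prob_space_normal_density[of 1 0]]
      by (subst nn_integral_cmult) (auto simp: emeasure_density)
    finally show ?thesis by simp
  qed
  have "(\<lambda>(x, y). Complex x y) \<in> borel_measurable (borel \<Otimes>\<^sub>M borel)"
    unfolding borel_prod case_prod_beta
    by (intro borel_measurable_continuous_onI continuous_intros)
  then have [measurable]: "(\<lambda>(x, y). Complex x y) \<in> borel_measurable (lborel \<Otimes>\<^sub>M lborel)"
    by (simp cong: measurable_cong_sets)
  have "(\<integral>\<^sup>+ z. ennreal (exp (- (1/2) * (cmod z)\<^sup>2)) \<partial>lborel) =
      (\<integral>\<^sup>+ x. \<integral>\<^sup>+ y. ennreal (exp (- (1/2) * x\<^sup>2)) * ennreal (exp (- (1/2) * y\<^sup>2)) \<partial>lborel \<partial>lborel)"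
    by (subst lborel_complex_eq_distr_pair, subst nn_integral_distr)
       (auto simp: lborel.nn_integral_fst[symmetric] cmod_power2 algebra_simps
          simp flip: ennreal_mult exp_add intro!: nn_integral_cong)
  also have "\<dots> = (\<integral>\<^sup>+ x. ennreal (exp (- (1/2) * x\<^sup>2)) * ennreal (sqrt (2 * pi)) \<partial>lborel)"
    by (subst nn_integral_cmult, measurable, simp only: 1)
  also have "\<dots> < \<infinity>"
    by (subst nn_integral_multc, measurable, simp only: 1) (simp add: ennreal_mult_less_top)
  finally show ?thesis .
qed

section \<open>Lebesgue spaces and pointwise bounds\<close>

lemma one_le_enn2real: "1 \<le> q \<Longrightarrow> q \<noteq> \<infinity> \<Longrightarrow> 1 \<le> enn2real q"
  by (cases q) (auto simp: ennreal_ge_1)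

lemma holomorphic_on_UNIV_imp_measurable:
  "f holomorphic_on UNIV \<Longrightarrow> f \<in> borel_measurable borel"
  by (intro borel_measurable_continuous_onI holomorphic_on_imp_continuous_on)

lemma L_fun_measurable:
  assumes "u holomorphic_on UNIV" "\<psi> holomorphic_on UNIV"
  shows "L_fun u \<psi> n \<in> borel_measurable borel"
  using assms[THEN holomorphic_on_UNIV_imp_measurable] unfolding L_fun_def by measurable

lemma cmod_gaussian_measurable [measurable]:
  "(\<lambda>z. exp (- (1/2) * (cmod z)\<^sup>2)) \<in> borel_measurable lebesgue"
  by (intro measurable_completion) simp

text \<open>For finite \<open>q\<close> this is the \<open>q\<close>-th power of the norm; only its
  finiteness and uniform bounds on it matter.\<close>

definition Lebesgue_size :: "ennreal \<Rightarrow> (complex \<Rightarrow> real) \<Rightarrow> ennreal" where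
  "Lebesgue_size q h =
     (if q = \<infinity> then esssup lebesgue (\<lambda>z. ennreal \<bar>h z\<bar>)
      else \<integral>\<^sup>+ z. ennreal (\<bar>h z\<bar> powr enn2real q) \<partial>lebesgue)"

lemma Lebesgue_space_iff:
  "h \<in> Lebesgue_space q lebesgue \<longleftrightarrow> h \<in> borel_measurable lebesgue \<and> Lebesgue_size q h < \<infinity>"
  by (simp add: Lebesgue_space_def Lebesgue_size_def)

lemma Lebesgue_size_mono:
  fixes f g :: "complex \<Rightarrow> real"
  assumes "g \<in> borel_measurable lebesgue" "AE z in lebesgue. \<bar>g z\<bar> \<le> \<bar>f z\<bar>"
  shows "Lebesgue_size q g \<le> Lebesgue_size q f"
proof (cases "q = \<infinity>")
  case True
  then show ?thesis
    using assms by (auto simp: Lebesgue_size_def ennreal_leI intro!: esssup_AE_mono)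
next
  case False
  have "AE z in lebesgue. ennreal (\<bar>g z\<bar> powr enn2real q) \<le> ennreal (\<bar>f z\<bar> powr enn2real q)"
    using assms(2) by eventually_elim (auto intro!: ennreal_leI powr_mono2)
  then show ?thesis
    using False by (auto simp: Lebesgue_size_def intro!: nn_integral_mono_AE)
qed

lemma Lebesgue_space_mono:
  fixes f g :: "complex \<Rightarrow> real"
  assumes "f \<in> Lebesgue_space q lebesgue" "g \<in> borel_measurable lebesgue"
    and "AE z in lebesgue. \<bar>g z\<bar> \<le> \<bar>f z\<bar>"
  shows "g \<in> Lebesgue_space q lebesgue"
  using assms Lebesgue_size_mono[of g f q] by (auto simp: Lebesgue_space_iff intro: le_less_trans)

lemma Lebesgue_space_cmult:
  fixes c :: real and f :: "complex \<Rightarrow> real"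
  assumes "f \<in> Lebesgue_space q lebesgue"
  shows "(\<lambda>z. c * f z) \<in> Lebesgue_space q lebesgue"
proof (cases "q = \<infinity>")
  case True
  have [measurable]: "f \<in> borel_measurable lebesgue"
    using assms by (simp add: Lebesgue_space_iff)
  have "AE z in lebesgue. ennreal \<bar>c * f z\<bar> \<le> ennreal \<bar>c\<bar> * esssup lebesgue (\<lambda>z. ennreal \<bar>f z\<bar>)"
    using esssup_AE[where f = "\<lambda>z. ennreal \<bar>f z\<bar>" and M = lebesgue]
    by eventually_elim (simp add: abs_mult ennreal_mult mult_left_mono)
  then have "esssup lebesgue (\<lambda>z. ennreal \<bar>c * f z\<bar>) \<le> ennreal \<bar>c\<bar> * esssup lebesgue (\<lambda>z. ennreal \<bar>f z\<bar>)"
    by (intro esssup_I) measurable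
  also have "\<dots> < \<infinity>"
    using assms True by (simp add: Lebesgue_space_def ennreal_mult_less_top)
  finally show ?thesis
    using True by (simp add: Lebesgue_space_def)
next
  case False
  have [measurable]: "f \<in> borel_measurable lebesgue"
    using assms by (simp add: Lebesgue_space_iff)
  have "(\<integral>\<^sup>+ z. ennreal (\<bar>c * f z\<bar> powr enn2real q) \<partial>lebesgue) =
      ennreal (\<bar>c\<bar> powr enn2real q) * (\<integral>\<^sup>+ z. ennreal (\<bar>f z\<bar> powr enn2real q) \<partial>lebesgue)"
    by (subst nn_integral_cmult[symmetric]) (auto simp: abs_mult powr_mult ennreal_mult)
  then show ?thesis
    using assms False by (simp add: Lebesgue_space_def ennreal_mult_less_top)
qed

text \<open>The \<open>q\<close>-th power of a maximum is at most the sum of the \<open>q\<close>-th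
  powers. Through \<open>|f + g| <= 2 * max |f| |g|\<close> this gives closure under sums without
  Minkowski's inequality.\<close>

lemma Lebesgue_space_max:
  fixes f g :: "complex \<Rightarrow> real"
  assumes "f \<in> Lebesgue_space q lebesgue" "g \<in> Lebesgue_space q lebesgue"
  shows "(\<lambda>z. max (\<bar>f z\<bar>) (\<bar>g z\<bar>)) \<in> Lebesgue_space q lebesgue"
proof (cases "q = \<infinity>")
  case True
  have [measurable]: "f \<in> borel_measurable lebesgue" "g \<in> borel_measurable lebesgue"
    using assms by (simp_all add: Lebesgue_space_iff)
  have "AE z in lebesgue. ennreal \<bar>max (\<bar>f z\<bar>) (\<bar>g z\<bar>)\<bar> \<le>
      max (esssup lebesgue (\<lambda>z. ennreal \<bar>f z\<bar>)) (esssup lebesgue (\<lambda>z. ennreal \<bar>g z\<bar>))"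
    using esssup_AE[where f = "\<lambda>z. ennreal \<bar>f z\<bar>" and M = lebesgue]
      esssup_AE[where f = "\<lambda>z. ennreal \<bar>g z\<bar>" and M = lebesgue]
    by eventually_elim (auto simp: max_def split: if_splits)
  then have "esssup lebesgue (\<lambda>z. ennreal \<bar>max (\<bar>f z\<bar>) (\<bar>g z\<bar>)\<bar>) \<le>
      max (esssup lebesgue (\<lambda>z. ennreal \<bar>f z\<bar>)) (esssup lebesgue (\<lambda>z. ennreal \<bar>g z\<bar>))"
    by (intro esssup_I) measurable
  also have "\<dots> < \<infinity>"
    using assms True by (simp add: Lebesgue_space_def)
  finally show ?thesis
    using True by (simp add: Lebesgue_space_def)
next
  case False
  have [measurable]: "f \<in> borel_measurable lebesgue" "g \<in> borel_measurable lebesgue"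
    using assms by (simp_all add: Lebesgue_space_iff)
  have "(\<integral>\<^sup>+ z. ennreal (\<bar>max (\<bar>f z\<bar>) (\<bar>g z\<bar>)\<bar> powr enn2real q) \<partial>lebesgue) \<le>
      (\<integral>\<^sup>+ z. ennreal (\<bar>f z\<bar> powr enn2real q) + ennreal (\<bar>g z\<bar> powr enn2real q) \<partial>lebesgue)"
    by (intro nn_integral_mono) (auto simp: max_def simp flip: ennreal_plus intro!: ennreal_leI)
  also have "\<dots> = (\<integral>\<^sup>+ z. ennreal (\<bar>f z\<bar> powr enn2real q) \<partial>lebesgue) +
      (\<integral>\<^sup>+ z. ennreal (\<bar>g z\<bar> powr enn2real q) \<partial>lebesgue)"
    by (intro nn_integral_add) measurable
  also have "\<dots> < \<infinity>"
    using assms False by (simp add: Lebesgue_space_def)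
  finally show ?thesis
    using False by (simp add: Lebesgue_space_def)
qed

lemma Lebesgue_space_add:
  fixes f g :: "complex \<Rightarrow> real"
  assumes "f \<in> Lebesgue_space q lebesgue" "g \<in> Lebesgue_space q lebesgue"
  shows "(\<lambda>z. f z + g z) \<in> Lebesgue_space q lebesgue"
proof (rule Lebesgue_space_mono[OF Lebesgue_space_cmult[OF Lebesgue_space_max[OF assms], of 2]])
  show "(\<lambda>z. f z + g z) \<in> borel_measurable lebesgue"
    using assms by (auto simp: Lebesgue_space_iff)
  show "AE z in lebesgue. \<bar>f z + g z\<bar> \<le> \<bar>2 * max (\<bar>f z\<bar>) (\<bar>g z\<bar>)\<bar>"
    by (intro AE_I2) (auto simp: max_def)
qed

text \<open>The Gaussian takes values in \<open>(0, 1]\<close>, so a power with exponent at least 1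
  only decreases it.\<close>

lemma gaussian_in_Lebesgue_space:
  assumes "1 \<le> q"
  shows "(\<lambda>z. exp (- (1/2) * (cmod z)\<^sup>2)) \<in> Lebesgue_space q lebesgue"
proof (cases "q = \<infinity>")
  case True
  have "esssup lebesgue (\<lambda>z. ennreal \<bar>exp (- (1/2) * (cmod z)\<^sup>2)\<bar>) \<le> ennreal 1"
    by (intro esssup_I measurable_completion AE_I2 ennreal_leI) auto
  also have "\<dots> < \<infinity>" by simp
  finally show ?thesis
    using True by (simp add: Lebesgue_space_def cmod_gaussian_measurable[simplified])
next
  case False
  have "(\<integral>\<^sup>+ z. ennreal (\<bar>exp (- (1/2) * (cmod z)\<^sup>2)\<bar> powr enn2real q) \<partial>lebesgue) \<le>
      (\<integral>\<^sup>+ z. ennreal (exp (- (1/2) * (cmod z)\<^sup>2)) \<partial>lebesgue)"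
  proof (intro nn_integral_mono ennreal_leI)
    fix z
    have "exp (- (1/2) * (cmod z)\<^sup>2) powr enn2real q \<le> exp (- (1/2) * (cmod z)\<^sup>2) powr 1"
      by (intro powr_mono' one_le_enn2real assms False) auto
    then show "\<bar>exp (- (1/2) * (cmod z)\<^sup>2)\<bar> powr enn2real q \<le> exp (- (1/2) * (cmod z)\<^sup>2)"
      by simp
  qed
  also have "\<dots> < \<infinity>"
    using nn_integral_gaussian_finite by (simp add: nn_integral_completion)
  finally show ?thesis
    using False by (simp add: Lebesgue_space_def cmod_gaussian_measurable[simplified])
qed

text \<open>Since \<open>exp (R^2 / 2 - |z|^2 / 2) >= 1\<close> for \<open>|z| <= R\<close>, a
  multiple of the Gaussian dominates \<open>f\<close> everywhere.\<close>

lemma bounded_on_bounded_in_Lebesgue_space: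
  fixes f :: "complex \<Rightarrow> real"
  assumes "1 \<le> q" "f \<in> borel_measurable lebesgue" "\<And>z. \<bar>f z\<bar> \<le> M" "\<And>z. cmod z > R \<Longrightarrow> f z = 0"
  shows "f \<in> Lebesgue_space q lebesgue"
proof (rule Lebesgue_space_mono[OF Lebesgue_space_cmult[OF gaussian_in_Lebesgue_space[OF assms(1)],
        of "M * exp (R\<^sup>2 / 2)"]])
  have "0 \<le> M" using order_trans[OF abs_ge_zero assms(3)] .
  have "\<bar>f z\<bar> \<le> \<bar>M * exp (R\<^sup>2 / 2) * exp (- (1/2) * (cmod z)\<^sup>2)\<bar>" for z
  proof (cases "cmod z > R")
    case False
    then have "(cmod z)\<^sup>2 \<le> R\<^sup>2" by (intro power_mono) auto
    then have "1 \<le> exp (R\<^sup>2 / 2 - (1/2) * (cmod z)\<^sup>2)" by simp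
    then have "M * 1 \<le> M * exp (R\<^sup>2 / 2 - (1/2) * (cmod z)\<^sup>2)"
      using \<open>0 \<le> M\<close> by (intro mult_left_mono)
    with assms(3)[of z] have "\<bar>f z\<bar> \<le> M * exp (R\<^sup>2 / 2 - (1/2) * (cmod z)\<^sup>2)"
      by linarith
    also have "\<dots> = M * exp (R\<^sup>2 / 2) * exp (- (1/2) * (cmod z)\<^sup>2)"
      by (simp flip: exp_add)
    finally show ?thesis by linarith
  qed (use assms(4) in simp)
  then show "AE z in lebesgue. \<bar>f z\<bar> \<le> \<bar>M * exp (R\<^sup>2 / 2) * exp (- (1/2) * (cmod z)\<^sup>2)\<bar>"
    by simp
qed fact

text \<open>For finite \<open>q\<close> the weight is the \<open>q\<close>-th power of
  \<open>exp (- |z|^2 / 2)\<close>, so it moves from the measure to the function. Finite and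
  infinite \<open>q\<close> can then be treated alike in the unweighted space.\<close>

lemma weighted_Lebesgue_space_iff:
  "h \<in> weighted_Lebesgue_space q \<longleftrightarrow> (\<lambda>z. h z * exp (- (1/2) * (cmod z)\<^sup>2)) \<in> Lebesgue_space q lebesgue"
proof -
  let ?g = "\<lambda>z::complex. exp (- (1/2) * (cmod z)\<^sup>2)"
  have meas: "(\<lambda>z. h z * ?g z) \<in> borel_measurable lebesgue \<longleftrightarrow> h \<in> borel_measurable lebesgue"
  proof
    assume [measurable]: "(\<lambda>z. h z * ?g z) \<in> borel_measurable lebesgue"
    have "(\<lambda>z. (h z * ?g z) / ?g z) \<in> borel_measurable lebesgue" by measurable
    then show "h \<in> borel_measurable lebesgue" by simp
  next
    assume [measurable]: "h \<in> borel_measurable lebesgue"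
    show "(\<lambda>z. h z * ?g z) \<in> borel_measurable lebesgue" by measurable
  qed
  show ?thesis
  proof (cases "q = \<infinity>")
    case True
    then show ?thesis
      by (simp only: weighted_Lebesgue_space_def Lebesgue_space_def meas if_True mem_Collect_eq abs_mult abs_exp_cancel simp_thms)
  next
    case False
    define r where "r = enn2real q"
    have "(\<integral>\<^sup>+ z. ennreal (\<bar>h z\<bar> powr r) \<partial>density lebesgue (\<lambda>z. ennreal (exp (- (r / 2) * (cmod z)\<^sup>2)))) =
      (\<integral>\<^sup>+ z. ennreal (\<bar>h z * ?g z\<bar> powr r) \<partial>lebesgue)"
      if [measurable]: "h \<in> borel_measurable lebesgue"
    proof -
      have [measurable]: "(\<lambda>z::complex. ennreal (exp (- (r / 2) * (cmod z)\<^sup>2))) \<in> borel_measurable lebesgue"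
        by (intro measurable_completion) simp
      have eq: "\<bar>h z * ?g z\<bar> powr r = exp (- (r / 2) * (cmod z)\<^sup>2) * \<bar>h z\<bar> powr r" for z
      proof -
        have "?g z powr r = exp (- (r / 2) * (cmod z)\<^sup>2)"
          by (simp add: exp_powr_real mult_ac)
        then show ?thesis
          by (simp only: abs_mult abs_exp_cancel powr_mult abs_ge_zero exp_ge_zero mult.commute)
      qed
      show ?thesis
        unfolding eq by (subst nn_integral_density) (measurable, simp add: ennreal_mult)
    qed
    then show ?thesis
      using False meas by (auto simp: weighted_Lebesgue_space_def Lebesgue_space_def r_def)
  qed
qed

text \<open>The area mean value inequality bounds \<open>L_fun\<close> at a point by its integral
  over a unit disc. The constant is uniform in all data, which later yields bounds on whole unit
  balls.\<close>

lemma L_fun_le_Lebesgue_size: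
  obtains K where "0 \<le> K"
    "\<And>q u \<psi> n N z. \<lbrakk>1 \<le> q; u holomorphic_on UNIV; \<psi> holomorphic_on UNIV; 0 \<le> N;
       Lebesgue_size q (L_fun u \<psi> n) \<le> ennreal N\<rbrakk> \<Longrightarrow> L_fun u \<psi> n z \<le> K * (1 + N)"
proof
  define m where "m = pi"
  have m: "emeasure lborel (ball z 1) = ennreal m" for z :: complex
    by (simp add: m_def emeasure_ball unit_ball_vol_2)
  have "m > 0"
    by (simp add: m_def)
  show "0 \<le> exp (1/2) * (1 + 1 / m)" using \<open>m > 0\<close> by simp
  fix q u \<psi> n N and z :: complex
  assume q: "1 \<le> q" and u: "u holomorphic_on UNIV" and \<psi>: "\<psi> holomorphic_on UNIV" and "0 \<le> N"
    and N: "Lebesgue_size q (L_fun u \<psi> n) \<le> ennreal N"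
  let ?L = "L_fun u \<psi> n"
  have [measurable]: "?L \<in> borel_measurable borel" "ball z 1 \<in> sets borel"
    using u \<psi> by (auto intro: L_fun_measurable)
  \<comment> \<open>The bound serves both ranges of \<open>q\<close>: \<open>m * N\<close> arises
    for \<open>q = \<infinity>\<close>, and \<open>m + N\<close> for finite \<open>q\<close> from
    \<open>t <= 1 + t^q\<close>, used in place of Hoelder's inequality.\<close>
  have "(\<integral>\<^sup>+ w. ennreal (?L w) * indicator (ball z 1) w \<partial>lborel) \<le> ennreal (m + N + m * N)"
  proof (cases "q = \<infinity>")
    case True
    then have *: "esssup lebesgue (\<lambda>w. ennreal \<bar>?L w\<bar>) \<le> ennreal N"
      using N by (simp add: Lebesgue_size_def)
    have "AE w in lebesgue. ennreal (?L w) \<le> ennreal N"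
      using esssup_AE[where f = "\<lambda>w. ennreal \<bar>?L w\<bar>" and M = lebesgue]
      by eventually_elim (use * in \<open>simp add: L_fun_nonneg\<close>)
    then have "AE w in lborel. ennreal (?L w) * indicator (ball z 1) w \<le> ennreal N * indicator (ball z 1) w"
      by (auto simp: AE_completion_iff indicator_def elim: eventually_mono)
    then have "(\<integral>\<^sup>+ w. ennreal (?L w) * indicator (ball z 1) w \<partial>lborel) \<le> (\<integral>\<^sup>+ w. ennreal N * indicator (ball z 1) w \<partial>lborel)"
      by (rule nn_integral_mono_AE)
    also have "\<dots> = ennreal (m * N)"
      using \<open>m > 0\<close> \<open>0 \<le> N\<close> by (subst nn_integral_cmult_indicator) (auto simp: m mult.commute ennreal_mult)
    also have "\<dots> \<le> ennreal (m + N + m * N)"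
      using \<open>m > 0\<close> \<open>0 \<le> N\<close> by (intro ennreal_leI) simp
    finally show ?thesis .
  next
    case False
    have "(\<integral>\<^sup>+ w. ennreal (?L w) * indicator (ball z 1) w \<partial>lborel) \<le>
       (\<integral>\<^sup>+ w. indicator (ball z 1) w + ennreal (\<bar>?L w\<bar> powr enn2real q) \<partial>lborel)"
    proof (intro nn_integral_mono)
      fix w
      have "?L w \<le> 1 + ?L w powr enn2real q"
      proof (cases "?L w \<le> 1")
        case False
        then have "?L w powr 1 \<le> ?L w powr enn2real q"
          using one_le_enn2real[OF q \<open>q \<noteq> \<infinity>\<close>] by (intro powr_mono) auto
        then show ?thesis using False by simp
      qed (simp add: add_increasing2)
      then have "ennreal (?L w) \<le> 1 + ennreal (\<bar>?L w\<bar> powr enn2real q)"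
        by (simp add: L_fun_nonneg ennreal_leI flip: ennreal_1 ennreal_plus)
      then show "ennreal (?L w) * indicator (ball z 1) w \<le>
          indicator (ball z 1) w + ennreal (\<bar>?L w\<bar> powr enn2real q)"
        by (auto simp: indicator_def)
    qed
    also have "\<dots> = (\<integral>\<^sup>+ w. indicator (ball z 1) w \<partial>lborel) + (\<integral>\<^sup>+ w. ennreal (\<bar>?L w\<bar> powr enn2real q) \<partial>lborel)"
      by (intro nn_integral_add) auto
    also have "\<dots> \<le> ennreal m + ennreal N"
      using N False by (intro add_mono) (auto simp: m Lebesgue_size_def nn_integral_completion)
    also have "\<dots> \<le> ennreal (m + N + m * N)"
      using \<open>m > 0\<close> \<open>0 \<le> N\<close> by (simp flip: ennreal_plus add: ennreal_leI)
    finally show ?thesis .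
  qed
  then have "ennreal m * ennreal (?L z) \<le> ennreal (exp (1/2)) * ennreal (m + N + m * N)"
    using L_fun_area_mean[OF u \<psi>, of n z] by (simp only: m) (meson mult_left_mono order_trans zero_le)
  then have "ennreal (m * ?L z) \<le> ennreal (exp (1/2) * (m + N + m * N))"
    using \<open>m > 0\<close> \<open>0 \<le> N\<close> by (simp add: ennreal_mult L_fun_nonneg del: ennreal_plus)
  then have "m * ?L z \<le> exp (1/2) * (m + N + m * N)"
    using \<open>m > 0\<close> \<open>0 \<le> N\<close> by (subst (asm) ennreal_le_iff) auto
  also have "\<dots> \<le> m * (exp (1/2) * (1 + 1 / m) * (1 + N))"
    using \<open>m > 0\<close> \<open>0 \<le> N\<close> by (simp add: field_simps)
  finally show "?L z \<le> exp (1/2) * (1 + 1 / m) * (1 + N)"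
    using \<open>m > 0\<close> by simp
qed

section \<open>Fock spaces\<close>

text \<open>The parameters \<open>0, 0\<close> make \<^const>\<open>L_fun\<close> the Gaussian-weighted modulus of its first argument.\<close>

lemma L_fun_zero_zero: "L_fun f (\<lambda>_. 0) 0 z = cmod (f z) * exp (- (1/2) * (cmod z)\<^sup>2)"
  by (simp add: L_fun_def)

lemma fock_norm_finite_exponent:
  fixes p :: ennreal
  defines "r \<equiv> enn2real p"
  assumes "p \<noteq> \<infinity>" "f holomorphic_on UNIV"
  shows "fock_norm p f =
    (let I = ennreal (r / (2 * pi)) * Lebesgue_size p (L_fun f (\<lambda>_. 0) 0)
     in if I = \<infinity> then \<infinity> else ennreal (enn2real I powr (1 / r)))"
proof -
  have "cmod (f z) powr r * exp (- (r/2) * (cmod z)\<^sup>2) = \<bar>L_fun f (\<lambda>_. 0) 0 z\<bar> powr r" for z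
  proof -
    have "exp (- (1/2) * (cmod z)\<^sup>2) powr r = exp (- (r / 2) * (cmod z)\<^sup>2)"
      by (simp add: exp_powr_real mult_ac)
    then show ?thesis
      by (simp only: L_fun_zero_zero abs_mult abs_exp_cancel powr_mult abs_ge_zero exp_ge_zero abs_norm_cancel)
  qed
  then show ?thesis
    using assms(2) by (simp add: fock_norm_def Lebesgue_size_def Let_def flip: r_def)
qed

lemma fock_norm_infinity: "fock_norm \<infinity> f = (SUP z. ennreal (L_fun f (\<lambda>_. 0) 0 z))"
  by (simp add: fock_norm_def L_fun_zero_zero)

lemma L_fun_in_Lebesgue_space_iff:
  assumes "u holomorphic_on UNIV" "\<psi> holomorphic_on UNIV"
  shows "L_fun u \<psi> n \<in> Lebesgue_space q lebesgue \<longleftrightarrow> Lebesgue_size q (L_fun u \<psi> n) < \<infinity>"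
  using L_fun_measurable[OF assms, of n] by (auto simp: Lebesgue_space_iff intro: measurable_completion)

lemma L_fun_bounded:
  assumes "1 \<le> q" "u holomorphic_on UNIV" "\<psi> holomorphic_on UNIV"
    and "L_fun u \<psi> n \<in> Lebesgue_space q lebesgue"
  obtains B where "\<And>z. L_fun u \<psi> n z \<le> B"
proof -
  obtain K where K: "\<And>q u \<psi> n N z. \<lbrakk>1 \<le> q; u holomorphic_on UNIV; \<psi> holomorphic_on UNIV; 0 \<le> N;
       Lebesgue_size q (L_fun u \<psi> n) \<le> ennreal N\<rbrakk> \<Longrightarrow> L_fun u \<psi> n z \<le> K * (1 + N)"
    by (rule L_fun_le_Lebesgue_size) blast
  have "Lebesgue_size q (L_fun u \<psi> n) \<le> ennreal (enn2real (Lebesgue_size q (L_fun u \<psi> n)))"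
    using assms(4) by (simp add: Lebesgue_space_iff less_top)
  from K[OF assms(1-3) _ this] that show ?thesis
    by auto
qed

text \<open>For \<open>p = \<infinity>\<close> a supremum must be compared with an essential
  supremum: if the latter is finite, the mean value estimate gives a bound at every point.\<close>

lemma fock_space_iff:
  assumes "1 \<le> p"
  shows "f \<in> fock_space p \<longleftrightarrow> f holomorphic_on UNIV \<and> L_fun f (\<lambda>_. 0) 0 \<in> Lebesgue_space p lebesgue"
proof (cases "f holomorphic_on UNIV")
  case f: True
  let ?L = "L_fun f (\<lambda>_. 0) 0"
  have iff: "?L \<in> Lebesgue_space p lebesgue \<longleftrightarrow> Lebesgue_size p ?L < \<infinity>"
    by (intro L_fun_in_Lebesgue_space_iff f holomorphic_on_const)
  have "fock_norm p f < \<infinity> \<longleftrightarrow> Lebesgue_size p ?L < \<infinity>"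
  proof (cases "p = \<infinity>")
    case True
    show ?thesis
    proof
      assume *: "fock_norm p f < \<infinity>"
      have "Lebesgue_size p ?L \<le> fock_norm p f"
        unfolding True fock_norm_infinity Lebesgue_size_def using iff
        by (auto simp: L_fun_nonneg intro!: esssup_I SUP_upper measurable_completion L_fun_measurable f)
      with * show "Lebesgue_size p ?L < \<infinity>" by (rule order.strict_trans1[rotated])
    next
      assume "Lebesgue_size p ?L < \<infinity>"
      then obtain B where "?L z \<le> B" for z
        using L_fun_bounded[OF assms f holomorphic_on_const] iff by metis
      then have "fock_norm p f \<le> ennreal B"
        unfolding True fock_norm_infinity by (intro SUP_least ennreal_leI)
      also have "\<dots> < \<infinity>" by simp
      finally show "fock_norm p f < \<infinity>" .
    qed
  next
    case False
    then show ?thesis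
      using one_le_enn2real[OF assms False]
      by (auto simp: fock_norm_finite_exponent f Let_def ennreal_mult_eq_top_iff less_top)
  qed
  then show ?thesis using f iff by (simp add: fock_space_def)
qed (simp add: fock_space_def)

text \<open>One bound for all \<open>p\<close>: with finite exponent \<open>r >= 1\<close> the size
  \<open>S\<close> satisfies \<open>r / (2 * pi) * S <= 1\<close>, hence \<open>S <= 2 * pi\<close>;
  for \<open>p = \<infinity>\<close> it is at most 1.\<close>

lemma Lebesgue_size_le_if_fock_norm_le_1:
  assumes "1 \<le> p" "f holomorphic_on UNIV" "fock_norm p f \<le> 1"
  shows "Lebesgue_size p (L_fun f (\<lambda>_. 0) 0) \<le> ennreal (2 * pi)"
proof (cases "p = \<infinity>")
  case True
  have "Lebesgue_size p (L_fun f (\<lambda>_. 0) 0) \<le> fock_norm p f"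
    unfolding True fock_norm_infinity Lebesgue_size_def
    by (auto simp: L_fun_nonneg intro!: esssup_I SUP_upper measurable_completion L_fun_measurable assms)
  also have "\<dots> \<le> ennreal 1" using assms by simp
  also have "\<dots> \<le> ennreal (2 * pi)"
    using pi_gt3 by (intro ennreal_leI) simp
  finally show ?thesis .
next
  case False
  define r where "r = enn2real p"
  let ?S = "Lebesgue_size p (L_fun f (\<lambda>_. 0) 0)"
  have r: "1 \<le> r" unfolding r_def by (intro one_le_enn2real assms False)
  have "?S < \<infinity>"
    using assms fock_space_iff[OF assms(1), of f]
    by (auto simp: fock_space_def Lebesgue_space_iff intro: order.strict_trans1)
  then obtain S where S: "?S = ennreal S" "0 \<le> S" by (cases ?S) auto
  have "ennreal ((r / (2 * pi) * S) powr (1 / r)) \<le> 1"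
    using assms(3) S r fock_norm_finite_exponent[OF False assms(2)]
    by (simp add: r_def[symmetric] Let_def flip: ennreal_mult)
  then have le: "(r / (2 * pi) * S) powr (1 / r) \<le> 1" by (simp add: ennreal_le_1)
  have "r / (2 * pi) * S \<le> 1"
  proof (rule ccontr)
    assume "\<not> ?thesis"
    then have "1 < (r / (2 * pi) * S) powr (1 / r)" using r by (intro gr_one_powr) auto
    with le show False by simp
  qed
  then have "r * S \<le> 2 * pi" by (simp add: field_simps)
  moreover have "S \<le> r * S" using r S(2) by (simp add: mult_le_cancel_right1)
  ultimately show ?thesis using S by (simp add: ennreal_leI)
qed

section \<open>Growth of derivatives\<close>

text \<open>Cauchy's estimate on a circle about \<open>w\<close>, fed with the pointwise growth
  bound for \<open>f\<close>; \<open>K\<close> depends on \<open>n\<close> only.\<close>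

lemma higher_deriv_bound:
  obtains K where "0 \<le> K"
    "\<And>p f N w. \<lbrakk>1 \<le> p; f holomorphic_on UNIV; 0 \<le> N; Lebesgue_size p (L_fun f (\<lambda>_. 0) 0) \<le> ennreal N\<rbrakk> \<Longrightarrow>
       cmod ((deriv ^^ n) f w) \<le> K * (1 + N) * ((1 + cmod w) ^ n * exp ((cmod w)\<^sup>2 / 2))"
proof -
  obtain K where "0 \<le> K" and K: "\<And>q u \<psi> n N z. \<lbrakk>1 \<le> q; u holomorphic_on UNIV; \<psi> holomorphic_on UNIV; 0 \<le> N;
       Lebesgue_size q (L_fun u \<psi> n) \<le> ennreal N\<rbrakk> \<Longrightarrow> L_fun u \<psi> n z \<le> K * (1 + N)"
    by (rule L_fun_le_Lebesgue_size) blast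
  show thesis
  proof
    show "0 \<le> fact n * K * exp (3/2)" using \<open>0 \<le> K\<close> by simp
    fix p f N w
    assume p: "1 \<le> p" and f: "f holomorphic_on UNIV" and "0 \<le> N"
      and N: "Lebesgue_size p (L_fun f (\<lambda>_. 0) 0) \<le> ennreal N"
    \<comment> \<open>On the circle of this radius \<open>|x|^2 <= |w|^2 + 3\<close>, so the
      Gaussian factor changes by a constant only, while \<open>1 / \<rho> ^ n\<close> is
      \<open>(1 + |w|) ^ n\<close>.\<close>
    define \<rho> where "\<rho> = 1 / (1 + cmod w)"
    have "0 < \<rho>" "\<rho> \<le> 1" "cmod w * \<rho> \<le> 1"
      using norm_ge_zero[of w] by (auto simp: \<rho>_def divide_le_eq add_pos_nonneg)
    have "cmod ((deriv ^^ n) f w) \<le> fact n * (K * (1 + N) * exp (3/2 + (cmod w)\<^sup>2 / 2)) / \<rho> ^ n"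
    proof (rule Cauchy_inequality)
      show "f holomorphic_on ball w \<rho>" "continuous_on (cball w \<rho>) f"
        using f by (auto intro: holomorphic_on_subset holomorphic_on_imp_continuous_on continuous_on_subset)
      fix x assume "cmod (w - x) = \<rho>"
      then have "cmod x \<le> cmod w + \<rho>"
        using norm_triangle_ineq2[of x w] by (simp add: norm_minus_commute)
      then have "(cmod x)\<^sup>2 \<le> (cmod w + \<rho>)\<^sup>2" by (intro power_mono) auto
      also have "\<dots> \<le> 3 + (cmod w)\<^sup>2"
        using \<open>cmod w * \<rho> \<le> 1\<close> power_le_one[of \<rho> 2] \<open>0 < \<rho>\<close> \<open>\<rho> \<le> 1\<close>
        by (simp add: power2_sum)
      finally have x: "(cmod x)\<^sup>2 / 2 \<le> 3/2 + (cmod w)\<^sup>2 / 2" by simp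
      have "cmod (f x) = L_fun f (\<lambda>_. 0) 0 x * exp ((cmod x)\<^sup>2 / 2)"
        by (simp add: L_fun_zero_zero exp_minus)
      also have "\<dots> \<le> K * (1 + N) * exp (3/2 + (cmod w)\<^sup>2 / 2)"
        using K[OF p f holomorphic_on_const \<open>0 \<le> N\<close> N] \<open>0 \<le> K\<close> \<open>0 \<le> N\<close> x
        by (intro mult_mono) auto
      finally show "cmod (f x) \<le> K * (1 + N) * exp (3/2 + (cmod w)\<^sup>2 / 2)" .
    qed fact
    also have "\<dots> = fact n * K * exp (3/2) * (1 + N) * ((1 + cmod w) ^ n * exp ((cmod w)\<^sup>2 / 2))"
      unfolding \<rho>_def exp_add by (simp add: power_one_over mult_ac)
    finally show "cmod ((deriv ^^ n) f w) \<le>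
      fact n * K * exp (3/2) * (1 + N) * ((1 + cmod w) ^ n * exp ((cmod w)\<^sup>2 / 2))" .
  qed
qed

section \<open>Kernel functions and their norms\<close>

lemma higher_deriv_exp_linear:
  fixes a s c :: complex
  shows "(deriv ^^ n) (\<lambda>z. c * exp (a * z - s)) = (\<lambda>z. c * a ^ n * exp (a * z - s))"
proof (induction n)
  case (Suc n)
  have "deriv (\<lambda>z. c * a ^ n * exp (a * z - s)) z = c * a ^ Suc n * exp (a * z - s)" for z
    by (rule DERIV_imp_deriv) (auto intro!: derivative_eq_intros)
  then show ?case by (simp add: Suc.IH fun_eq_iff)
qed simp

text \<open>In the Fock space with exponent 2, \<open>exp (cnj w * z)\<close> is the reproducing
  kernel at \<open>w\<close> and \<open>exp (|w|^2 / 2)\<close> its norm; \<open>c\<close> is an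
  additional scaling.\<close>

definition fock_kernel :: "real \<Rightarrow> complex \<Rightarrow> complex \<Rightarrow> complex" where
  "fock_kernel c w = (\<lambda>z. of_real c * exp (cnj w * z - of_real ((cmod w)\<^sup>2 / 2)))"

lemma fock_kernel_holomorphic: "fock_kernel c w holomorphic_on UNIV"
  unfolding fock_kernel_def by (intro holomorphic_intros)

text \<open>With the Gaussian weight, the modulus of the kernel is \<open>c\<close> times the
  Gaussian centred at \<open>w\<close>. By translation invariance its norm does not depend on
  \<open>w\<close>, so a single \<open>c\<close> serves all \<open>w\<close>.\<close>

lemma fock_kernel_norm_le_1:
  assumes "1 \<le> p"
  obtains c where "0 < c" "\<And>w. fock_norm p (fock_kernel c w) \<le> 1" "\<And>w. fock_kernel c w \<in> fock_space p"
proof -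
  have L: "L_fun (fock_kernel c w) (\<lambda>_. 0) 0 z = c * exp (- (1/2) * (cmod (z - w))\<^sup>2)" if "c > 0" for c w z
  proof -
    have "Re (cnj w * z - of_real ((cmod w)\<^sup>2 / 2)) + - (1/2) * (cmod z)\<^sup>2 = - (1/2) * (cmod (z - w))\<^sup>2"
      unfolding minus_complex.sel Re_complex_of_real Re_cnj_mult by (simp add: field_simps)
    then show ?thesis
      unfolding L_fun_zero_zero fock_kernel_def norm_mult norm_exp_eq_Re using that
      by (simp only: norm_of_real abs_of_pos mult.assoc flip: exp_add)
  qed
  have "\<exists>c>0. \<forall>w. fock_norm p (fock_kernel c w) \<le> 1"
  proof (cases "p = \<infinity>")
    case True
    have "fock_norm p (fock_kernel 1 w) \<le> 1" for w
      unfolding True fock_norm_infinity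
      by (intro SUP_least) (simp add: L)
    then show ?thesis by (intro exI[of _ 1]) simp
  next
    case False
    define r where "r = enn2real p"
    have r: "1 \<le> r" unfolding r_def by (intro one_le_enn2real assms False)
    obtain S where S: "(\<integral>\<^sup>+ z. ennreal (exp (- (1/2) * (cmod z)\<^sup>2) powr r) \<partial>lebesgue) = ennreal S" "0 \<le> S"
      using gaussian_in_Lebesgue_space[OF assms] False
      by (cases "(\<integral>\<^sup>+ z. ennreal (exp (- (1/2) * (cmod z)\<^sup>2) powr r) \<partial>lebesgue)")
         (auto simp: Lebesgue_space_def r_def)
    define M where "M = r / (2 * pi) * S"
    have "0 \<le> M" using S r by (simp add: M_def)
    \<comment> \<open>Since \<open>c <= 1 <= r\<close>, this choice gives
      \<open>c powr r * M <= c * M <= 1\<close>.\<close>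
    define c where "c = 1 / (1 + M)"
    have c: "0 < c" "c \<le> 1" "c * M \<le> 1"
      using \<open>0 \<le> M\<close> by (auto simp: c_def)
    have "fock_norm p (fock_kernel c w) \<le> 1" for w
    proof -
      have eq: "\<bar>L_fun (fock_kernel c w) (\<lambda>_. 0) 0 z\<bar> powr r = c powr r * exp (- (1/2) * (cmod (- w + z))\<^sup>2) powr r" for z
        using \<open>0 < c\<close> by (simp add: L powr_mult)
      have "Lebesgue_size p (L_fun (fock_kernel c w) (\<lambda>_. 0) 0) =
         (\<integral>\<^sup>+ z. ennreal (c powr r) * ennreal (exp (- (1/2) * (cmod (- w + z))\<^sup>2) powr r) \<partial>lborel)"
        using False by (simp add: Lebesgue_size_def nn_integral_completion eq ennreal_mult flip: r_def)
      also have "\<dots> = ennreal (c powr r) * (\<integral>\<^sup>+ z. ennreal (exp (- (1/2) * (cmod (- w + z))\<^sup>2) powr r) \<partial>lborel)"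
        by (intro nn_integral_cmult) simp
      also have "\<dots> = ennreal (c powr r) * ennreal S"
        by (subst nn_integral_lborel_translate[where c = "- w"]) (simp_all add: S(1)[unfolded nn_integral_completion, simplified])
      finally have "ennreal (r / (2 * pi)) * Lebesgue_size p (L_fun (fock_kernel c w) (\<lambda>_. 0) 0) = ennreal (c powr r * M)"
        using S r by (simp add: M_def mult_ac flip: ennreal_mult)
      then have "fock_norm p (fock_kernel c w) = ennreal ((c powr r * M) powr (1 / r))"
        using \<open>0 \<le> M\<close> by (simp add: fock_norm_finite_exponent[OF False fock_kernel_holomorphic] Let_def flip: r_def)
      also have "\<dots> \<le> ennreal 1"
      proof (intro ennreal_leI powr_le1)
        have "c powr r * M \<le> c powr 1 * M"
          using c r \<open>0 \<le> M\<close> by (intro mult_right_mono powr_mono') auto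
        then show "\<bar>c powr r * M\<bar> \<le> 1" using c \<open>0 \<le> M\<close> by simp
      qed (use r \<open>0 \<le> M\<close> in auto)
      finally show ?thesis by simp
    qed
    then show ?thesis using \<open>0 < c\<close> by blast
  qed
  then obtain c where c: "0 < c" "\<And>w. fock_norm p (fock_kernel c w) \<le> 1" by blast
  moreover have "fock_kernel c w \<in> fock_space p" for w
    using c(2)[of w] fock_kernel_holomorphic[of c w] by (auto simp: fock_space_def intro: order.strict_trans1)
  ultimately show thesis by (rule that)
qed

section \<open>Order boundedness\<close>

text \<open>
  At a zero of \<open>\<psi>\<close> the functional \<open>f \<mapsto> f\<^sup>(\<^sup>n\<^sup>) (\<psi> z)\<close> does not degenerate although \<^const>\<open>L_fun\<close> vanishes;
  its true size is governed by \<open>(1 + |\<psi> z|)\<^sup>n\<close>.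
\<close>

definition L_reg :: "(complex \<Rightarrow> complex) \<Rightarrow> (complex \<Rightarrow> complex) \<Rightarrow> nat \<Rightarrow> complex \<Rightarrow> real" where
  "L_reg u \<psi> n z = cmod (u z) * (1 + cmod (\<psi> z)) ^ n * exp ((1/2) * ((cmod (\<psi> z))\<^sup>2 - (cmod z)\<^sup>2))"

lemma L_reg_nonneg: "0 \<le> L_reg u \<psi> n z"
  by (simp add: L_reg_def)

lemma L_reg_measurable:
  assumes "u holomorphic_on UNIV" "\<psi> holomorphic_on UNIV"
  shows "L_reg u \<psi> n \<in> borel_measurable lebesgue"
proof -
  note [measurable] = assms[THEN holomorphic_on_UNIV_imp_measurable]
  have "L_reg u \<psi> n \<in> borel_measurable borel"
    unfolding L_reg_def by measurable
  then show ?thesis by (intro measurable_completion) simp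
qed

text \<open>Rests on \<open>1 + t <= (1 + 1 / \<delta>) * t\<close> for
  \<open>t >= \<delta>\<close>: away from the zeros of \<open>\<psi>\<close> the two functions are
  comparable.\<close>

lemma L_reg_le_L_fun:
  assumes "0 < \<delta>" "\<delta> \<le> cmod (\<psi> z)"
  shows "L_reg u \<psi> n z \<le> (1 + 1 / \<delta>) ^ n * L_fun u \<psi> n z"
proof -
  have "1 + cmod (\<psi> z) \<le> (1 + 1 / \<delta>) * cmod (\<psi> z)"
    using assms by (simp add: field_simps)
  then have "(1 + cmod (\<psi> z)) ^ n \<le> ((1 + 1 / \<delta>) * cmod (\<psi> z)) ^ n"
    by (intro power_mono) auto
  then have "cmod (u z) * (1 + cmod (\<psi> z)) ^ n \<le> cmod (u z) * ((1 + 1 / \<delta>) ^ n * cmod (\<psi> z) ^ n)"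
    unfolding power_mult_distrib by (intro mult_left_mono) auto
  then have "L_reg u \<psi> n z \<le> (cmod (u z) * ((1 + 1 / \<delta>) ^ n * cmod (\<psi> z) ^ n)) *
      exp ((1/2) * ((cmod (\<psi> z))\<^sup>2 - (cmod z)\<^sup>2))"
    unfolding L_reg_def by (intro mult_right_mono) auto
  then show ?thesis by (simp add: L_fun_def mult_ac)
qed

text \<open>A nonconstant polynomial tends to infinity in modulus.\<close>

lemma quadratic_constant_or_large:
  fixes b0 b1 b2 :: complex
  assumes "\<And>z. \<psi> z = b0 + b1 * z + b2 * z\<^sup>2"
  obtains (const) "\<And>z. \<psi> z = b0" | (large) R where "\<And>z. R < cmod z \<Longrightarrow> 1 \<le> cmod (\<psi> z)"
proof (cases "b1 = 0 \<and> b2 = 0")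
  case False
  let ?p = "[:b0, b1, b2:]"
  have "poly ?p z = \<psi> z" for z
    by (simp add: assms power2_eq_square algebra_simps)
  moreover have "\<exists>r. \<forall>z. r \<le> cmod z \<longrightarrow> 1 \<le> cmod (poly [:b0, b1, b2:] z)"
    using poly_infinity[of "[:b1, b2:]" 1 b0] False by auto
  ultimately show ?thesis using large by (metis less_le_not_le)
qed (use assms const in auto)

text \<open>The condition \<open>nz\<close> excludes \<open>n > 0\<close> with \<open>\<psi>\<close>
  identically zero, where \<open>L_fun\<close> vanishes whatever \<open>u\<close> is. In the
  substantial case \<open>\<psi>\<close> turns out to be a polynomial, so its small values occur on
  a bounded set or it is a nonzero constant.\<close>

lemma L_reg_in_Lebesgue_space:
  assumes q: "1 \<le> q" and u: "u holomorphic_on UNIV" and \<psi>: "\<psi> holomorphic_on UNIV"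
    and L: "L_fun u \<psi> n \<in> Lebesgue_space q lebesgue"
    and nz: "n = 0 \<or> (\<exists>z. \<psi> z \<noteq> 0)"
  shows "L_reg u \<psi> n \<in> Lebesgue_space q lebesgue"
proof -
  have comparable: ?thesis if "\<And>z. L_reg u \<psi> n z \<le> C * L_fun u \<psi> n z" for C
    using that order_trans[OF L_reg_nonneg that]
    by (intro Lebesgue_space_mono[OF Lebesgue_space_cmult[OF L, of C]] L_reg_measurable u \<psi> AE_I2)
       (simp add: L_reg_nonneg)
  consider "n = 0" | "\<And>z. u z = 0" | z0 w where "n > 0" "u z0 \<noteq> 0" "\<psi> w \<noteq> 0"
    using nz by blast
  then show ?thesis
  proof cases
    case 1
    then show ?thesis by (intro comparable[of 1]) (simp add: L_reg_def L_fun_def)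
  next
    case 2
    then show ?thesis by (intro comparable[of 0]) (simp add: L_reg_def)
  next
    case 3
    \<comment> \<open>Otherwise \<open>\<psi>\<close> would vanish on the nonempty open set where
      \<open>u\<close> is nonzero, hence everywhere.\<close>
    have "\<exists>z. u z * \<psi> z ^ n \<noteq> 0"
    proof (rule ccontr)
      assume *: "\<not> ?thesis"
      have "\<psi> w = 0"
      proof (rule analytic_continuation_open[of "{z. u z \<noteq> 0}" UNIV \<psi> "\<lambda>_. 0"])
        show "open {z. u z \<noteq> 0}"
          using u by (intro open_Collect_neq continuous_intros) (auto intro: holomorphic_on_imp_continuous_on)
      qed (use * \<psi> 3 in auto)
      with 3 show False by simp
    qed
    then obtain z1 where z1: "u z1 * \<psi> z1 ^ n \<noteq> 0" by blast
    obtain B where B: "\<And>z. L_fun u \<psi> n z \<le> B"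
      using L_fun_bounded[OF q u \<psi> L] by blast
    \<comment> \<open>Multiplied by \<open>exp (|z|^2 / 2)\<close>, the bound on
      \<open>L_fun\<close> becomes the growth hypothesis for
      \<open>v = u * \<psi> ^ n\<close>.\<close>
    have "cmod (u z * \<psi> z ^ n) * exp ((cmod (\<psi> z))\<^sup>2 / 2) \<le> B * exp ((cmod z)\<^sup>2 / 2)" for z
      using mult_right_mono[OF B[of z], of "exp ((cmod z)\<^sup>2 / 2)"]
      by (simp add: L_fun_def norm_mult norm_power diff_divide_distrib exp_diff)
    moreover have "(\<lambda>z. u z * \<psi> z ^ n) holomorphic_on UNIV"
      by (intro holomorphic_intros u \<psi>)
    ultimately obtain b0 b1 b2 where b: "\<And>z. \<psi> z = b0 + b1 * z + b2 * z\<^sup>2"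
      using quadratic_if_gaussian_growth[where v = "\<lambda>z. u z * \<psi> z ^ n", OF _ \<psi> z1] by blast
    from b show ?thesis
    proof (cases rule: quadratic_constant_or_large)
      case const
      then have "0 < cmod b0" using 3 by simp
      then show ?thesis using const by (intro comparable[OF L_reg_le_L_fun[of "cmod b0"]]) auto
    next
      case (large R)
      \<comment> \<open>\<open>f\<close> is the part over the disc of radius \<open>R\<close>,
        bounded by compactness. Outside, \<open>|\<psi>| >= 1\<close> permits the comparison with
        \<open>\<delta> = 1\<close>, whence the factor \<open>1 + 1 / 1\<close>.\<close>
      define f where "f z = indicator (cball 0 R) z * L_reg u \<psi> n z" for z
      have "continuous_on UNIV (L_reg u \<psi> n)"
        unfolding L_reg_def using u \<psi> by (intro continuous_intros holomorphic_on_imp_continuous_on)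
      then have "bounded (L_reg u \<psi> n ` cball 0 R)"
        by (intro compact_imp_bounded compact_continuous_image) (auto intro: continuous_on_subset)
      then obtain M where M: "\<And>z. cmod z \<le> R \<Longrightarrow> L_reg u \<psi> n z \<le> M" "0 \<le> M"
        unfolding bounded_pos by (force simp: L_reg_nonneg)
      have "f \<in> Lebesgue_space q lebesgue"
      proof (rule bounded_on_bounded_in_Lebesgue_space[OF q])
        show "f \<in> borel_measurable lebesgue"
          unfolding f_def using L_reg_measurable[OF u \<psi>, of n] by (intro borel_measurable_times borel_measurable_indicator) auto
        show "\<bar>f z\<bar> \<le> M" for z
          using M by (auto simp: f_def indicator_def L_reg_nonneg)
        show "f z = 0" if "R < cmod z" for z
          using that by (simp add: f_def)
      qed
      then have *: "(\<lambda>z. f z + (1 + 1 / 1) ^ n * L_fun u \<psi> n z) \<in> Lebesgue_space q lebesgue"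
        by (intro Lebesgue_space_add Lebesgue_space_cmult L)
      have "L_reg u \<psi> n z \<le> f z + (1 + 1 / 1) ^ n * L_fun u \<psi> n z" for z
      proof (cases "cmod z \<le> R")
        case True
        then show ?thesis by (simp add: f_def L_fun_nonneg)
      next
        case False
        then show ?thesis
          using L_reg_le_L_fun[of 1 \<psi> z u n] large[of z] by (simp add: f_def)
      qed
      then show ?thesis
        by (intro Lebesgue_space_mono[OF *] L_reg_measurable u \<psi> AE_I2)
           (simp add: L_reg_nonneg order_trans[OF _ abs_ge_self])
    qed
  qed
qed

section \<open>Sufficiency\<close>

lemma weighted_comp_diff_holomorphic:
  assumes "u holomorphic_on UNIV" "\<psi> holomorphic_on UNIV" "f holomorphic_on UNIV"
  shows "weighted_comp_diff u \<psi> n f holomorphic_on UNIV"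
  unfolding weighted_comp_diff_def using assms
  by (intro holomorphic_intros holomorphic_on_compose_gen[of \<psi> UNIV "(deriv ^^ n) f" UNIV, unfolded o_def]
      holomorphic_higher_deriv) auto

text \<open>The derivative bound at \<open>\<psi> z\<close> controls the image of \<open>f\<close>
  by a multiple of \<open>L_reg\<close> times \<open>exp (|z|^2 / 2)\<close>. This gives both the
  mapping property and a common majorant for the unit ball.\<close>

lemma order_bounded_if_L_reg:
  assumes p: "1 \<le> p" and q: "1 \<le> q" and u: "u holomorphic_on UNIV" and \<psi>: "\<psi> holomorphic_on UNIV"
    and L: "L_reg u \<psi> n \<in> Lebesgue_space q lebesgue"
  shows "order_bounded p q (weighted_comp_diff u \<psi> n)"
proof -
  let ?T = "weighted_comp_diff u \<psi> n"
  obtain K where "0 \<le> K" and K: "\<And>p f N w. \<lbrakk>1 \<le> p; f holomorphic_on UNIV; 0 \<le> N;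
       Lebesgue_size p (L_fun f (\<lambda>_. 0) 0) \<le> ennreal N\<rbrakk> \<Longrightarrow>
       cmod ((deriv ^^ n) f w) \<le> K * (1 + N) * ((1 + cmod w) ^ n * exp ((cmod w)\<^sup>2 / 2))"
    by (rule higher_deriv_bound[of n]) blast
  have bound: "cmod (?T f z) \<le> K * (1 + N) * L_reg u \<psi> n z * exp ((cmod z)\<^sup>2 / 2)"
    if "f holomorphic_on UNIV" "0 \<le> N" "Lebesgue_size p (L_fun f (\<lambda>_. 0) 0) \<le> ennreal N" for f N z
  proof -
    have "cmod (?T f z) \<le> cmod (u z) * (K * (1 + N) * ((1 + cmod (\<psi> z)) ^ n * exp ((cmod (\<psi> z))\<^sup>2 / 2)))"
      unfolding weighted_comp_diff_def norm_mult by (intro mult_left_mono K[OF p] that) auto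
    also have "exp ((cmod (\<psi> z))\<^sup>2 / 2) = exp ((1/2) * ((cmod (\<psi> z))\<^sup>2 - (cmod z)\<^sup>2)) * exp ((cmod z)\<^sup>2 / 2)"
      by (simp add: field_simps flip: exp_add)
    finally show ?thesis by (simp add: L_reg_def mult_ac)
  qed
  have "?T f \<in> fock_space q" if f: "f \<in> fock_space p" for f
  proof -
    have hol: "f holomorphic_on UNIV" and size: "Lebesgue_size p (L_fun f (\<lambda>_. 0) 0) < \<infinity>"
      using f fock_space_iff[OF p] by (auto simp: Lebesgue_space_iff)
    define N where "N = enn2real (Lebesgue_size p (L_fun f (\<lambda>_. 0) 0))"
    have N: "0 \<le> N" "Lebesgue_size p (L_fun f (\<lambda>_. 0) 0) \<le> ennreal N"
      using size by (simp_all add: N_def less_top)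
    have hT: "?T f holomorphic_on UNIV"
      by (intro weighted_comp_diff_holomorphic u \<psi> hol)
    have "L_fun (?T f) (\<lambda>_. 0) 0 z \<le> K * (1 + N) * L_reg u \<psi> n z" for z
      using mult_right_mono[OF bound[OF hol N, of z], of "exp (- (1/2) * (cmod z)\<^sup>2)"]
      by (simp add: L_fun_zero_zero mult.assoc exp_minus)
    then have "L_fun (?T f) (\<lambda>_. 0) 0 \<in> Lebesgue_space q lebesgue"
      by (intro Lebesgue_space_mono[OF Lebesgue_space_cmult[OF L, of "K * (1 + N)"]] AE_I2
          measurable_completion)
         (auto simp: L_fun_nonneg intro: L_fun_measurable hT order_trans[OF _ abs_ge_self])
    with hT show ?thesis using fock_space_iff[OF q] by blast
  qed
  \<comment> \<open>Here \<open>2 * pi\<close> is the size bound for the unit ball, and the added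
    Gaussian keeps \<open>h\<close> positive where \<open>L_reg\<close> vanishes.\<close>
  moreover define h where "h z = (K * (1 + 2 * pi) * L_reg u \<psi> n z + exp (- (1/2) * (cmod z)\<^sup>2)) * exp ((cmod z)\<^sup>2 / 2)" for z
  have "h \<in> weighted_Lebesgue_space q"
  proof -
    have "(\<lambda>z. K * (1 + 2 * pi) * L_reg u \<psi> n z + exp (- (1/2) * (cmod z)\<^sup>2)) \<in> Lebesgue_space q lebesgue"
      by (intro Lebesgue_space_add Lebesgue_space_cmult L gaussian_in_Lebesgue_space q)
    then show ?thesis
      unfolding weighted_Lebesgue_space_iff h_def mult.assoc by (simp flip: exp_add)
  qed
  moreover have "h z > 0" for z
    unfolding h_def using \<open>0 \<le> K\<close>
    by (intro mult_pos_pos add_nonneg_pos mult_nonneg_nonneg L_reg_nonneg) auto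
  moreover have "cmod (?T f z) \<le> h z" if "f \<in> fock_space p" "fock_norm p f \<le> 1" for f z
  proof -
    have hol: "f holomorphic_on UNIV" using that by (simp add: fock_space_def)
    have "cmod (?T f z) \<le> K * (1 + 2 * pi) * L_reg u \<psi> n z * exp ((cmod z)\<^sup>2 / 2)"
      by (intro bound hol Lebesgue_size_le_if_fock_norm_le_1 p that) auto
    also have "\<dots> \<le> h z" unfolding h_def by (intro mult_right_mono) auto
    finally show ?thesis .
  qed
  ultimately show ?thesis
    unfolding order_bounded_def by blast
qed

section \<open>Necessity\<close>

lemma order_bounded_imp_L_fun:
  assumes p: "1 \<le> p" and u: "u holomorphic_on UNIV" and \<psi>: "\<psi> holomorphic_on UNIV"
    and ob: "order_bounded p q (weighted_comp_diff u \<psi> n)"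
  shows "L_fun u \<psi> n \<in> Lebesgue_space q lebesgue"
proof -
  let ?T = "weighted_comp_diff u \<psi> n"
  obtain h where h: "h \<in> weighted_Lebesgue_space q" "\<And>z. h z > 0"
    and Th: "\<And>f. f \<in> fock_space p \<Longrightarrow> fock_norm p f \<le> 1 \<Longrightarrow> AE z in lebesgue. cmod (?T f z) \<le> h z"
    using ob unfolding order_bounded_def by blast
  obtain c where "0 < c" and c: "\<And>w. fock_norm p (fock_kernel c w) \<le> 1" "\<And>w. fock_kernel c w \<in> fock_space p"
    by (rule fock_kernel_norm_le_1[OF p]) blast
  \<comment> \<open>The modulus of the operator applied to the kernel at \<open>w\<close>, in a
    closed form that is visibly continuous in \<open>w\<close>.\<close>
  define E where "E w z = c * cmod (u z) * cmod w ^ n * exp (Re (cnj w * \<psi> z - of_real ((cmod w)\<^sup>2 / 2)))" for w z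
  have "AE z in lebesgue. cmod (?T (fock_kernel c w) z) \<le> h z" for w
    by (intro Th c)
  moreover have "cmod (?T (fock_kernel c w) z) = E w z" for w z
    using \<open>0 < c\<close> unfolding weighted_comp_diff_def fock_kernel_def higher_deriv_exp_linear E_def
    by (simp add: norm_mult norm_power)
  ultimately have AE: "AE z in lebesgue. E w z \<le> h z" for w
    by simp
  \<comment> \<open>The exceptional null set depends on the kernel. Countably many \<open>w\<close>
    share one null set, and continuity then admits every \<open>w\<close>, including
    \<open>\<psi> z\<close>, which varies with \<open>z\<close>.\<close>
  obtain D :: "complex set" where D: "countable D" "closure D = UNIV"
    using separable[of "UNIV :: complex set"] by (metis top.extremum_uniqueI)
  have "AE z in lebesgue. \<forall>w\<in>D. E w z \<le> h z"
    using AE D(1) by (simp add: AE_ball_countable)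
  then have "AE z in lebesgue. c * L_fun u \<psi> n z \<le> h z * exp (- (1/2) * (cmod z)\<^sup>2)"
  proof eventually_elim
    case (elim z)
    have "E (\<psi> z) z \<le> h z"
    proof (rule continuous_le_on_closure[of D "\<lambda>w. E w z"])
      show "continuous_on (closure D) (\<lambda>w. E w z)"
        unfolding E_def by (intro continuous_intros) auto
    qed (use elim D in auto)
    moreover have "Re (cnj (\<psi> z) * \<psi> z - of_real ((cmod (\<psi> z))\<^sup>2 / 2)) = (cmod (\<psi> z))\<^sup>2 / 2"
      unfolding minus_complex.sel Re_complex_of_real Re_cnj_mult by simp
    ultimately have "c * cmod (u z) * cmod (\<psi> z) ^ n * exp ((cmod (\<psi> z))\<^sup>2 / 2) \<le> h z"
      by (simp only: E_def)
    from mult_right_mono[OF this, of "exp (- (1/2) * (cmod z)\<^sup>2)"] show ?case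
      by (simp add: L_fun_def mult.assoc diff_divide_distrib flip: exp_add)
  qed
  then have le: "AE z in lebesgue. \<bar>L_fun u \<psi> n z\<bar> \<le> \<bar>1 / c * (h z * exp (- (1/2) * (cmod z)\<^sup>2))\<bar>"
  proof eventually_elim
    case (elim z)
    then have "L_fun u \<psi> n z \<le> 1 / c * (h z * exp (- (1/2) * (cmod z)\<^sup>2))"
      using \<open>0 < c\<close> by (simp add: field_simps)
    then show ?case using L_fun_nonneg[of u \<psi> n z] by linarith
  qed
  have meas: "L_fun u \<psi> n \<in> borel_measurable lebesgue"
    using L_fun_measurable[OF u \<psi>] by (intro measurable_completion) simp
  have "(\<lambda>z. 1 / c * (h z * exp (- (1/2) * (cmod z)\<^sup>2))) \<in> Lebesgue_space q lebesgue"
    using h(1) unfolding weighted_Lebesgue_space_iff by (rule Lebesgue_space_cmult)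
  then show ?thesis
    using meas le by (rule Lebesgue_space_mono)
qed

text \<open>If \<open>n > 0\<close> and \<open>\<psi>\<close> is identically zero, then
  \<open>L_fun\<close> vanishes for every \<open>u\<close>, while the operator sends
  \<open>f\<close> to the multiple of \<open>u\<close> by the \<open>n\<close>-th derivative of
  \<open>f\<close> at \<open>0\<close>. In this case the last assumption, that the operator maps
  between the two Fock spaces, supplies the information on \<open>u\<close>.\<close>

theorem theorem1p6:
  fixes u \<psi> :: "complex \<Rightarrow> complex" and n :: nat and p q :: ennreal
  assumes "u holomorphic_on UNIV" and "\<psi> holomorphic_on UNIV"
    and "1 \<le> p" and "1 \<le> q"
    and "n > 0 \<and> (\<forall>z. \<psi> z = 0) \<Longrightarrow> weighted_comp_diff u \<psi> n \<in> fock_space p \<rightarrow> fock_space q"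
  shows "order_bounded p q (weighted_comp_diff u \<psi> n) \<longleftrightarrow>
         L_fun u \<psi> n \<in> Lebesgue_space q lebesgue"
proof
  assume "order_bounded p q (weighted_comp_diff u \<psi> n)"
  then show "L_fun u \<psi> n \<in> Lebesgue_space q lebesgue"
    by (rule order_bounded_imp_L_fun[OF assms(3,1,2)])
next
  assume L: "L_fun u \<psi> n \<in> Lebesgue_space q lebesgue"
  have "L_reg u \<psi> n \<in> Lebesgue_space q lebesgue"
  proof (cases "n > 0 \<and> (\<forall>z. \<psi> z = 0)")
    case True
    obtain c where "0 < c" and "\<And>w. fock_kernel c w \<in> fock_space p"
      by (rule fock_kernel_norm_le_1[OF assms(3)]) blast
    \<comment> \<open>At \<open>0\<close> every derivative of the kernel with \<open>w = 1\<close>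
      equals \<open>c * exp (- 1/2)\<close>, which is nonzero, so the image of \<open>k\<close> is a
      nonzero multiple of \<open>u\<close>; with \<open>\<psi> = 0\<close> its weighted modulus is
      that multiple of \<open>L_reg\<close>.\<close>
    define k where "k = fock_kernel c 1"
    have "k \<in> fock_space p"
      unfolding k_def by fact
    then have Tk: "weighted_comp_diff u \<psi> n k \<in> fock_space q"
      using assms(5)[OF True] by blast
    define a where "a = c * exp (- 1/2)"
    have "a > 0" using \<open>0 < c\<close> by (simp add: a_def)
    have "cmod (weighted_comp_diff u \<psi> n k z) = a * cmod (u z)" for z
      using True \<open>0 < c\<close> unfolding weighted_comp_diff_def k_def fock_kernel_def higher_deriv_exp_linear
      by (simp add: norm_mult a_def)
    then have "L_fun (weighted_comp_diff u \<psi> n k) (\<lambda>_. 0) 0 = (\<lambda>z. a * L_reg u \<psi> n z)"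
      using True by (auto simp: L_fun_zero_zero L_reg_def)
    then have "(\<lambda>z. a * L_reg u \<psi> n z) \<in> Lebesgue_space q lebesgue"
      using Tk fock_space_iff[OF assms(4)] by simp
    from Lebesgue_space_cmult[OF this, of "1 / a"] show ?thesis
      using \<open>a > 0\<close> by simp
  next
    case False
    then show ?thesis
      by (intro L_reg_in_Lebesgue_space assms L) auto
  qed
  then show "order_bounded p q (weighted_comp_diff u \<psi> n)"
    by (intro order_bounded_if_L_reg assms)
qed

end
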